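(* Let $P$ be a 3-colorable convex polytope with $2n$ vertices, with a fixed proper coloring of its faces by $1,2,3$, let $m_i$ be the number of faces colored by $i$, and let $\widetilde P$ be the convex hull of the face-vertex incident vectors of $P$, with vertex set $S=V_1\cup V_2\cup V_3$. Suppose $m_3=m_2>m_1\geq 2$. Then a Gale diagram of $\widetilde P$ lies in $\mathbb{R}$ and consists of the point $0$ with multiplicity $m_1$, the point $1$ with multiplicity $m_2$, and the point $-1$ with multiplicity $m_3$. Hence: (1) for $J\subsetneq S$, $\operatorname{conv}(J)$ is a proper face of $\widetilde P$ if and only if either ($V_2\not\subseteq J$ and $V_3\not\subseteq J$) or $V_2\cup V_3\subseteq J$; (2) $\widetilde P$ is not a simplicial convex polytope. Furthermore, (3) $\widetilde P$ is combinatorially equivalent to an $m_1$-fold $n$-pyramid (denoted $T^{n,m_1}_{m_2-1}$) with basis $C(2m_2,2m_2-2)$, the $(2m_2-2)$-dimensional cyclic polytope with $2m_2$ vertices.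
   Context: A convex polytope $P$ is 3-colorable if it is 3-dimensional and simple (each vertex belongs to exactly three 2-dimensional faces) and each facet can be assigned a color in $\{1,2,3\}$ so that adjacent facets have different colors. "Face of $P$" means 2-dimensional face. Such a $P$ has an even number $2n$ of vertices and $n+2$ faces. Identify the vertex set of $P$ with $\{1,\dots,2n\}$. For a face $f$ of $P$, $\xi_f\in\{0,1\}^{2n}\subseteq\mathbb{R}^{2n}$ (the face-vertex incident vector) has entry $1$ at $v$ if $v\in f$ and $0$ otherwise. Let $S=\{\xi_f: f\text{ a face of }P\}$, $\widetilde P=\operatorname{conv}(S)$. The vertex set of $\widetilde P$ is exactly $S$, of size $n+2$. Put $V_i=\{\xi_f: f\text{ is colored by }i\}$, so $|V_i|=m_i$. Gale transform/diagram: for a list $v_1,\dots,v_N$ of column vectors in a Euclidean space with $d=\dim\operatorname{conv}\{v_1,\dots,v_N\}$, choose a basis $\beta_1,\dots,\beta_{N-d-1}$ of the null space of the matrix $\begin{bmatrix}1&\cdots&1\\ v_1&\cdots&v_N\end{bmatrix}$ and let $\bar v_j\in\mathbb{R}^{N-d-1}$ be the $j$-th row of $[\beta_1,\dots,\beta_{N-d-1}]$. The multiset $\{\bar v_j\}$ is a Gale transform. Replacing each nonzero $\bar v_j$ by $\bar v_j/\|\bar v_j\|$ (and leaving zero vectors as $0$) gives a Gale diagram. A Gale diagram of a polytope is one of its vertex set. A proper face is a face different from the whole polytope (the empty face is allowed). A polytope is simplicial if all its proper faces are simplices. A $d$-pyramid with basis $K$ is the convex hull of a $(d-1)$-polytope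 $K$ and a point (apex) outside the affine hull of $K$. A $0$-fold pyramid with basis $K$ is $K$ itself, and an $r$-fold $d$-pyramid with basis $K$ is a $d$-pyramid whose basis is an $(r-1)$-fold $(d-1)$-pyramid with basis $K$. $C(v,d)$ is the cyclic $d$-polytope with $v$ vertices (convex hull of $v$ distinct points on the moment curve in $\mathbb{R}^d$). Two polytopes are combinatorially equivalent if their face lattices are isomorphic. *)

theory Defs
  imports "HOL-Analysis.Analysis" "HOL-Library.Multiset"
begin

definition vertices :: "'a::euclidean_space set \<Rightarrow> 'a set" where
  "vertices P = {x. x extreme_point_of P}"

definition facets :: "'a::euclidean_space set \<Rightarrow> 'a set set" where
  "facets P = {f. f facet_of P}"

definition simple_3_polytope :: "'a::euclidean_space set \<Rightarrow> bool" where
  "simple_3_polytope P \<longleftrightarrow> polytope P \<and> aff_dim P = 3 \<and>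
     (\<forall>x\<in>vertices P. card {f \<in> facets P. x \<in> f} = 3)"

(* Two facets of a 3-polytope are adjacent if they share an edge. *)
definition facet_3_coloring :: "'a::euclidean_space set \<Rightarrow> ('a set \<Rightarrow> nat) \<Rightarrow> bool" where
  "facet_3_coloring P col \<longleftrightarrow>
     (\<forall>f\<in>facets P. col f \<in> {1, 2, 3}) \<and>
     (\<forall>f\<in>facets P. \<forall>g\<in>facets P. (f \<inter> g) edge_of P \<longrightarrow> col f \<noteq> col g)"

definition three_colorable :: "'a::euclidean_space set \<Rightarrow> bool" where
  "three_colorable P \<longleftrightarrow> simple_3_polytope P \<and> (\<exists>col. facet_3_coloring P col)"

definition color_class :: "'a::euclidean_space set \<Rightarrow> ('a set \<Rightarrow> nat) \<Rightarrow> nat \<Rightarrow> 'a set set" where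
  "color_class P col i = {f \<in> facets P. col f = i}"

(* lab enumerates the vertices of P by a finite type, so that the incidence
   vectors live in the Euclidean space indexed by that type. *)
definition incidence_vec :: "('v::finite \<Rightarrow> 'a) \<Rightarrow> 'a set \<Rightarrow> real^'v" where
  "incidence_vec lab f = (\<chi> i. if lab i \<in> f then 1 else 0)"

definition incidence_polytope ::
    "('v::finite \<Rightarrow> 'a::euclidean_space) \<Rightarrow> 'a set \<Rightarrow> (real^'v) set" where
  "incidence_polytope lab P = convex hull (incidence_vec lab ` facets P)"

(* The null space of the matrix whose j-th column is (1, v j). *)
definition affine_relations :: "('i::finite \<Rightarrow> 'e::euclidean_space) \<Rightarrow> (real^'i) set" where
  "affine_relations v = {c. (\<Sum>j\<in>UNIV. c $ j) = 0 \<and> (\<Sum>j\<in>UNIV. (c $ j) *\<^sub>R v j) = 0}"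

(* g j is the j-th row of the matrix whose columns, indexed by the standard basis of
   the target space, form a basis of the null space.  The target space, whose dimension
   is N - d - 1, has to be a nontrivial Euclidean space, so the affinely independent
   case N = d + 1 is not covered. *)
definition gale_transform ::
    "('i::finite \<Rightarrow> 'e::euclidean_space) \<Rightarrow> ('i \<Rightarrow> 'g::euclidean_space) \<Rightarrow> bool" where
  "gale_transform v g \<longleftrightarrow>
     int DIM('g) = int CARD('i) - aff_dim (convex hull (range v)) - 1 \<and>
     (let col = (\<lambda>b. (\<chi> j. g j \<bullet> b) :: real^'i) in
        inj_on col Basis \<and> independent (col ` Basis) \<and>
        span (col ` Basis) = affine_relations v)"

(* sgn x is x /\<^sub>R norm x for nonzero x, and sgn 0 = 0. *)
definition gale_diagram ::
    "('i::finite \<Rightarrow> 'e::euclidean_space) \<Rightarrow> 'g::euclidean_space multiset \<Rightarrow> bool" where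
  "gale_diagram v D \<longleftrightarrow>
     (\<exists>g. gale_transform v g \<and> D = image_mset (\<lambda>j. sgn (g j)) (mset_set UNIV))"

(* The enumeration v of the vertices is explicit only because of its finite index type;
   the multisets D obtained do not depend on it. *)
definition polytope_gale_diagram ::
    "('i::finite \<Rightarrow> 'e::euclidean_space) \<Rightarrow> 'e set \<Rightarrow> 'g::euclidean_space multiset \<Rightarrow> bool" where
  "polytope_gale_diagram v Q D \<longleftrightarrow> bij_betw v UNIV (vertices Q) \<and> gale_diagram v D"

definition proper_face_of :: "'a::euclidean_space set \<Rightarrow> 'a set \<Rightarrow> bool" where
  "proper_face_of F Q \<longleftrightarrow> F face_of Q \<and> F \<noteq> Q"

(* The empty face is the (-1)-simplex. *)
definition simplicial_polytope :: "'a::euclidean_space set \<Rightarrow> bool" where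
  "simplicial_polytope Q \<longleftrightarrow>
     polytope Q \<and> (\<forall>F. proper_face_of F Q \<longrightarrow> (\<exists>k. k simplex F))"

definition is_pyramid :: "int \<Rightarrow> 'a::euclidean_space set \<Rightarrow> 'a set \<Rightarrow> bool" where
  "is_pyramid d K Q \<longleftrightarrow> polytope K \<and> aff_dim K = d - 1 \<and>
     (\<exists>a. a \<notin> affine hull K \<and> Q = convex hull (insert a K))"

primrec is_fold_pyramid ::
    "nat \<Rightarrow> int \<Rightarrow> 'a::euclidean_space set \<Rightarrow> 'a set \<Rightarrow> bool" where
  "is_fold_pyramid 0 d K Q \<longleftrightarrow> polytope K \<and> aff_dim K = d \<and> Q = K"
| "is_fold_pyramid (Suc r) d K Q \<longleftrightarrow>
     (\<exists>B. is_fold_pyramid r (d - 1) K B \<and> is_pyramid d B Q)"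

(* The moment curve t \<mapsto> (t, t^2, ..., t^d) lies in R^d, embedded in the ambient space as
   the coordinate subspace spanned by the distinct standard basis vectors e 1, ..., e d;
   the ambient space may be larger, to leave room for the apexes of pyramids. *)
definition is_cyclic_polytope :: "nat \<Rightarrow> nat \<Rightarrow> 'a::euclidean_space set \<Rightarrow> bool" where
  "is_cyclic_polytope v d K \<longleftrightarrow>
     (\<exists>(e :: nat \<Rightarrow> 'a) (T :: real set).
        inj_on e {1..d} \<and> e ` {1..d} \<subseteq> Basis \<and> finite T \<and> card T = v \<and>
        K = convex hull ((\<lambda>t. \<Sum>k=1..d. (t ^ k) *\<^sub>R e k) ` T))"

definition combinatorially_equivalent ::
    "'a::euclidean_space set \<Rightarrow> 'b::euclidean_space set \<Rightarrow> bool" where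
  "combinatorially_equivalent P Q \<longleftrightarrow>
     (\<exists>\<phi>. bij_betw \<phi> {F. F face_of P} {G. G face_of Q} \<and>
        (\<forall>F F'. F face_of P \<longrightarrow> F' face_of P \<longrightarrow> (F \<subseteq> F' \<longleftrightarrow> \<phi> F \<subseteq> \<phi> F')))"

end

theory Submission
  imports Defs
begin

text \<open>
  Each vertex of \<open>P\<close> lies on three facets, any two of which share an edge, so it lies on exactly one facet
  of each colour.  A combination of the incidence vectors with weights \<open>c\<close> vanishes iff the three weights
  around every vertex add up to zero.  Moving along an edge keeps two of the three facets, and the third one
  is replaced by a facet of the same colour, whose weight is then forced to be the same.  Since any two
  vertices are joined by a path of edges, \<open>c\<close> is constant on each colour class, with constants \<open>k1, k2, k3\<close>
  of sum zero (\<open>facet_weights_vanishing_at_vertices\<close>).  An affine relation satisfies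
  \<open>m 1 * k1 + m 2 * k2 + m 3 * k3 = 0\<close> in addition, and because \<open>m 2 = m 3 \<noteq> m 1\<close> this leaves only the multiples
  of the weight that is \<open>0\<close>, \<open>1\<close>, \<open>-1\<close> on the three classes (\<open>incidence_gale_line\<close>).  That weight is
  the Gale diagram.

  The rest holds for every point configuration whose affine relations form a line, spanned by a weight \<open>w\<close> with at
  least two positive and two negative entries (locale \<open>gale_line\<close>).  Comparing two convex combinations of the
  same point can only produce a multiple of \<open>w\<close>, and this decides which subsets span faces in terms of the signs
  of \<open>w\<close> alone (\<open>face_iff_gale_face\<close>).  Hence the points where \<open>w\<close> is nonzero span a proper face with two more
  vertices than its dimension, which is not a simplex; points where \<open>w\<close> vanishes are
  apexes of an iterated pyramid (\<open>gale_line_fold_pyramid\<close>); and two configurations with equal sign patterns have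
  isomorphic face lattices (\<open>gale_line_combinatorially_equivalent\<close>).  For the last claim it remains to exhibit
  a configuration with the same signs: \<open>2 * m 2\<close> points on the moment curve, whose only relation
  alternates in sign along the curve, together with \<open>m 1\<close> unit vectors for the apexes
  (\<open>cyclic_pyramid_gale_line\<close>).

  That the pyramid has dimension \<open>n\<close> means that \<open>P\<close> has \<open>n + 2\<close> facets, which is Euler's formula for simple
  3-polytopes (\<open>simple_3_polytope_euler\<close>), obtained by counting the lowest and the highest vertex of each facet with
  respect to a generic linear functional.
\<close>

section \<open>A simple 3-polytope near a vertex\<close>

text \<open>
  Indexing the halfspaces of a minimal description by the facets themselves requires that different halfspaces
  cut out different facets.  By minimality some point violates just one inequality; the segment from it to a
  relative interior point meets the boundary in a point that lies on that facet and on no other.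
\<close>

lemma polyhedron_facet_inequalities:
  fixes P :: "'a::euclidean_space set"
  assumes "polyhedron P" "P \<noteq> {}"
  obtains a b where
    "\<And>x. x \<in> P \<longleftrightarrow> x \<in> affine hull P \<and> (\<forall>f\<in>facets P. a f \<bullet> x \<le> b f)"
    "\<And>f x. f \<in> facets P \<Longrightarrow> x \<in> f \<longleftrightarrow> x \<in> P \<and> a f \<bullet> x = b f"
proof -
  obtain F where finF: "finite F" and seq: "P = affine hull P \<inter> \<Inter>F"
    and hs: "\<forall>h\<in>F. \<exists>a b. a \<noteq> 0 \<and> h = {x. a \<bullet> x \<le> b}"
    and psub: "\<And>F'. F' \<subset> F \<Longrightarrow> P \<subset> affine hull P \<inter> \<Inter>F'"
    using assms(1) unfolding polyhedron_Int_affine_minimal by blast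
  from hs obtain a where "\<forall>h\<in>F. \<exists>b. a h \<noteq> 0 \<and> h = {x. a h \<bullet> x \<le> b}"
    by metis
  then obtain b where "\<forall>h\<in>F. a h \<noteq> 0 \<and> h = {x. a h \<bullet> x \<le> b h}"
    by metis
  then have ab: "a h \<noteq> 0 \<and> h = {x. a h \<bullet> x \<le> b h}" if "h \<in> F" for h
    using that by blast
  have memh: "x \<in> h \<longleftrightarrow> a h \<bullet> x \<le> b h" if "h \<in> F" for x h
    using ab[OF that] by blast
  have facet: "C facet_of P \<longleftrightarrow> (\<exists>h. h \<in> F \<and> C = P \<inter> {x. a h \<bullet> x = b h})" for C
    by (rule facet_of_polyhedron_explicit[OF finF seq ab psub])
  have relint: "rel_interior P = {x \<in> P. \<forall>h\<in>F. a h \<bullet> x < b h}"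
    by (rule rel_interior_polyhedron_explicit[OF finF seq ab psub])
  define fac where "fac = (\<lambda>h. P \<inter> {x. a h \<bullet> x = b h})"
  have facets: "facets P = fac ` F"
    unfolding facets_def facet fac_def by auto
  have inj: "inj_on fac F"
  proof (rule inj_onI, rule ccontr)
    fix h h' assume h: "h \<in> F" "h' \<in> F" "fac h = fac h'" "h \<noteq> h'"
    have "P \<subset> affine hull P \<inter> \<Inter>(F - {h})"
      using h by (intro psub) auto
    then obtain x where x: "x \<in> affine hull P" "x \<in> \<Inter>(F - {h})" "x \<notin> P"
      by blast
    have xg: "a g \<bullet> x \<le> b g" if "g \<in> F" "g \<noteq> h" for g
      using x(2) memh[OF that(1)] that by blast
    have xh: "a h \<bullet> x > b h"
    proof (rule ccontr)
      assume "\<not> ?thesis"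
      then have "x \<in> \<Inter>F" using xg memh by (metis InterI linorder_not_le)
      then show False using x seq by blast
    qed
    have "rel_interior P \<noteq> {}"
      using assms rel_interior_eq_empty polyhedron_imp_convex by blast
    then obtain z where z: "z \<in> P" "\<And>g. g \<in> F \<Longrightarrow> a g \<bullet> z < b g"
      unfolding relint by blast
    define t where "t = (b h - a h \<bullet> z) / (a h \<bullet> x - a h \<bullet> z)"
    have zh: "a h \<bullet> z < b h" using z h by blast
    have t: "0 < t" "t < 1" using zh xh unfolding t_def by (auto simp: field_simps)
    \<comment> \<open>The point where the segment from \<open>z\<close> to \<open>x\<close> crosses the hyperplane of \<open>h\<close>.\<close>
    define y where "y = (1 - t) *\<^sub>R z + t *\<^sub>R x"
    have yval: "a g \<bullet> y = (1 - t) * (a g \<bullet> z) + t * (a g \<bullet> x)" for g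
      unfolding y_def by (simp add: inner_add_right)
    have "t * (a h \<bullet> x - a h \<bullet> z) = b h - a h \<bullet> z"
      using zh xh unfolding t_def by simp
    then have yh: "a h \<bullet> y = b h" unfolding yval by (simp add: algebra_simps)
    have yg: "a g \<bullet> y < b g" if "g \<in> F" "g \<noteq> h" for g
    proof -
      have "(1 - t) * (a g \<bullet> z) < (1 - t) * b g" using z(2)[OF that(1)] t by simp
      moreover have "t * (a g \<bullet> x) \<le> t * b g" using xg[OF that] t by simp
      ultimately show ?thesis unfolding yval by (simp add: algebra_simps)
    qed
    have "y \<in> affine hull P"
      unfolding y_def using mem_affine[OF affine_affine_hull, of z P x "1 - t" t] x z
      by (simp add: hull_inc)
    moreover have "y \<in> \<Inter>F" using yg yh memh by (metis InterI le_less)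
    ultimately have "y \<in> P" using seq by blast
    then have "y \<in> fac h" using yh by (simp add: fac_def)
    moreover have "y \<notin> fac h'" using yg[OF h(2)] h(4) by (simp add: fac_def)
    ultimately show False using h by simp
  qed
  define g where "g = the_inv_into F fac"
  have g: "g f \<in> F" "fac (g f) = f" if "f \<in> facets P" for f
    using that inj unfolding facets g_def
    by (auto simp: the_inv_into_f_f)
  have gfac: "g (fac h) = h" if "h \<in> F" for h
    using inj that unfolding g_def by (simp add: the_inv_into_f_f)
  show ?thesis
  proof
    show "x \<in> P \<longleftrightarrow> x \<in> affine hull P \<and> (\<forall>f\<in>facets P. (a \<circ> g) f \<bullet> x \<le> (b \<circ> g) f)" for x
    proof -
      have "x \<in> P \<longleftrightarrow> x \<in> affine hull P \<and> x \<in> \<Inter>F" using seq by blast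
      also have "x \<in> \<Inter>F \<longleftrightarrow> (\<forall>h\<in>F. a h \<bullet> x \<le> b h)" using memh by blast
      finally show ?thesis by (simp add: facets gfac)
    qed
    show "x \<in> f \<longleftrightarrow> x \<in> P \<and> (a \<circ> g) f \<bullet> x = (b \<circ> g) f" if "f \<in> facets P" for f x
      using g(2)[OF that] unfolding fac_def comp_def by blast
  qed
qed

text \<open>
  For each facet \<open>f\<close> through \<open>v\<close>, \<open>w f\<close> is the other end of the edge at \<open>v\<close> that leaves \<open>f\<close>, the intersection
  of the remaining facets through \<open>v\<close>.  The polytope lies in the cone that these edges span at \<open>v\<close>; the coordinate
  \<open>lam f\<close> in this cone is proportional to the distance from the facet \<open>f\<close>.
\<close>

definition edge_cone :: "'a::euclidean_space set \<Rightarrow> 'a \<Rightarrow> ('a set \<Rightarrow> 'a) \<Rightarrow> ('a set \<Rightarrow> 'a \<Rightarrow> real) \<Rightarrow> bool" where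
  "edge_cone P v w lam \<longleftrightarrow>
     (\<forall>f\<in>facets P. v \<in> f \<longrightarrow> w f \<in> vertices P \<and>
        (\<forall>g\<in>facets P. v \<in> g \<longrightarrow> (w f \<in> g \<longleftrightarrow> f \<noteq> g)) \<and>
        (\<forall>x\<in>P. 0 \<le> lam f x \<and> (lam f x = 0 \<longleftrightarrow> x \<in> f))) \<and>
     (\<forall>x\<in>P. x - v = (\<Sum>f\<in>{f \<in> facets P. v \<in> f}. lam f x *\<^sub>R (w f - v)))"

lemma edge_coneD:
  assumes "edge_cone P v w lam"
  shows "\<And>f. f \<in> facets P \<Longrightarrow> v \<in> f \<Longrightarrow> w f \<in> vertices P"
    "\<And>f g. f \<in> facets P \<Longrightarrow> v \<in> f \<Longrightarrow> g \<in> facets P \<Longrightarrow> v \<in> g \<Longrightarrow> w f \<in> g \<longleftrightarrow> f \<noteq> g"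
    "\<And>f x. f \<in> facets P \<Longrightarrow> v \<in> f \<Longrightarrow> x \<in> P \<Longrightarrow> 0 \<le> lam f x"
    "\<And>f x. f \<in> facets P \<Longrightarrow> v \<in> f \<Longrightarrow> x \<in> P \<Longrightarrow> lam f x = 0 \<longleftrightarrow> x \<in> f"
    "\<And>x. x \<in> P \<Longrightarrow> x - v = (\<Sum>f\<in>{f \<in> facets P. v \<in> f}. lam f x *\<^sub>R (w f - v))"
proof -
  note D = assms[unfolded edge_cone_def]
  show "w f \<in> vertices P" if "f \<in> facets P" "v \<in> f" for f
    using conjunct1[OF D] that by blast
  show "w f \<in> g \<longleftrightarrow> f \<noteq> g" if "f \<in> facets P" "v \<in> f" "g \<in> facets P" "v \<in> g" for f g
    using conjunct1[OF D, rule_format, OF that(1,2)] that(3,4) by simp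
  show "0 \<le> lam f x" "lam f x = 0 \<longleftrightarrow> x \<in> f" if "f \<in> facets P" "v \<in> f" "x \<in> P" for f x
    using conjunct1[OF D, rule_format, OF that(1,2)] that(3) by simp_all
  show "x - v = (\<Sum>f\<in>{f \<in> facets P. v \<in> f}. lam f x *\<^sub>R (w f - v))" if "x \<in> P" for x
    using conjunct2[OF D] that by (rule bspec)
qed

text \<open>
  A direction along which none of the three facet inequalities at \<open>v\<close> changes can be followed both ways inside
  the polytope, so it is zero because \<open>v\<close> is extreme.  Hence the three inequalities are coordinates on the
  3-dimensional space of directions, and the dual basis points along the edges.  The dual vectors are scaled so that they end
  in a vertex of their edge.
\<close>

lemma simple_polytope_edge_cone:
  fixes P :: "'a::euclidean_space set"
  assumes P: "simple_3_polytope P" and v: "v \<in> vertices P"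
  shows "\<exists>w lam. edge_cone P v w lam"
proof -
  have poly: "polytope P" and dim3: "aff_dim P = 3"
    and card3: "card {f \<in> facets P. v \<in> f} = 3"
    using P v unfolding simple_3_polytope_def by auto
  have ex: "v extreme_point_of P" using v unfolding vertices_def by simp
  then have vP: "v \<in> P" unfolding extreme_point_of_def by simp
  have polyh: "polyhedron P" using poly by (rule polytope_imp_polyhedron)
  obtain a b where
    ab: "\<And>x. x \<in> P \<longleftrightarrow> x \<in> affine hull P \<and> (\<forall>f\<in>facets P. a f \<bullet> x \<le> b f)"
      and fab: "\<And>f x. f \<in> facets P \<Longrightarrow> x \<in> f \<longleftrightarrow> x \<in> P \<and> a f \<bullet> x = b f"
    using polyhedron_facet_inequalities[OF polyh] vP by blast
  have finfac: "finite (facets P)"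
    using finite_polyhedron_facets[OF polyh] unfolding facets_def .
  define A where "A = {f \<in> facets P. v \<in> f}"
  have finA: "finite A" unfolding A_def using finfac by simp
  have Afac: "f \<in> facets P" "a f \<bullet> v = b f" if "f \<in> A" for f
    using that fab[of f v] unfolding A_def by auto
  have memA: "x \<in> f \<longleftrightarrow> x \<in> P \<and> a f \<bullet> x = b f" if "f \<in> A" for f x
    using fab[OF Afac(1)[OF that]] by blast
  have nonA: "a f \<bullet> v < b f" if "f \<in> facets P" "f \<notin> A" for f
  proof -
    have "v \<notin> f" using that unfolding A_def by simp
    then have "a f \<bullet> v \<noteq> b f" using fab[OF that(1), of v] vP by blast
    moreover have "a f \<bullet> v \<le> b f" using ab vP that by blast
    ultimately show ?thesis by simp
  qed
  define L where "L = span ((+) (- v) ` P)"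
  have subL: "subspace L" unfolding L_def by simp
  have aff: "affine hull P = (+) v ` L"
    unfolding L_def using affine_hull_span_gen[of v P] vP by (simp add: hull_inc)
  have dimL: "dim L = 3"
    unfolding L_def using aff_dim_eq_dim[of v P] vP dim3 by (simp add: hull_inc)
  have inL: "x - v \<in> L" if "x \<in> P" for x
  proof -
    have "x \<in> affine hull P" using that by (simp add: hull_inc)
    then show ?thesis unfolding aff by auto
  qed
  have feas: "\<exists>t>0. v + t *\<^sub>R d \<in> P" if d: "d \<in> L" "\<And>f. f \<in> A \<Longrightarrow> a f \<bullet> d \<le> 0" for d
  proof -
    \<comment> \<open>Bounds on the step length from the inequalities that are inactive at \<open>v\<close>; the element \<open>1\<close> keeps the set
      nonempty, and the summand \<open>1\<close> keeps the denominators positive.\<close>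
    define B where "B = insert 1 ((\<lambda>f. (b f - a f \<bullet> v) / (\<bar>a f \<bullet> d\<bar> + 1)) ` (facets P - A))"
    have finB: "finite B" unfolding B_def using finfac by simp
    define t where "t = Min B"
    have "t \<in> B" unfolding t_def using finB by (intro Min_in) (auto simp: B_def)
    then have t: "t > 0" unfolding B_def using nonA by (auto intro!: divide_pos_pos simp: add_nonneg_pos)
    have "v + t *\<^sub>R d \<in> affine hull P"
      unfolding aff using d(1) subL by (auto intro: subspace_scale)
    moreover have "a f \<bullet> (v + t *\<^sub>R d) \<le> b f" if f: "f \<in> facets P" for f
    proof (cases "f \<in> A")
      case True
      have "t * (a f \<bullet> d) \<le> 0" using t d(2)[OF True] by (simp add: mult_nonneg_nonpos)
      then show ?thesis using Afac(2)[OF True] by (simp add: inner_add_right)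
    next
      case False
      have "t \<le> (b f - a f \<bullet> v) / (\<bar>a f \<bullet> d\<bar> + 1)"
        unfolding t_def using finB f False by (intro Min_le) (auto simp: B_def)
      then have "t * (\<bar>a f \<bullet> d\<bar> + 1) \<le> b f - a f \<bullet> v" by (simp add: field_simps)
      moreover have "t * (a f \<bullet> d) \<le> t * (\<bar>a f \<bullet> d\<bar> + 1)" using t by (intro mult_left_mono) auto
      ultimately show ?thesis by (simp add: inner_add_right)
    qed
    ultimately show ?thesis using ab t by blast
  qed
  have inj0: "d = 0" if d: "d \<in> L" "\<And>f. f \<in> A \<Longrightarrow> a f \<bullet> d = 0" for d
  proof (rule ccontr)
    assume "d \<noteq> 0"
    obtain s where s: "s > 0" "v + s *\<^sub>R d \<in> P" using feas[of d] d by auto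
    obtain t where t: "t > 0" "v + t *\<^sub>R (- d) \<in> P" using feas[of "- d"] d subspace_neg[OF subL] by auto
    have "v \<in> open_segment (v + s *\<^sub>R d) (v + t *\<^sub>R (- d))"
      unfolding in_segment
    proof (intro conjI exI)
      have "(s + t) *\<^sub>R d \<noteq> 0" using \<open>d \<noteq> 0\<close> s t by simp
      then show "v + s *\<^sub>R d \<noteq> v + t *\<^sub>R - d"
        by (simp add: scaleR_add_left eq_neg_iff_add_eq_0)
      show "0 < s / (s + t)" "s / (s + t) < 1" using s t by (auto simp: field_simps)
      define r where "r = s / (s + t)"
      have r: "(1 - r) * s - r * t = 0" unfolding r_def using s t by (simp add: field_simps)
      have "(1 - r) *\<^sub>R (v + s *\<^sub>R d) + r *\<^sub>R (v + t *\<^sub>R - d) = v + ((1 - r) * s - r * t) *\<^sub>R d"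
        by (simp add: algebra_simps)
      then have "v = (1 - r) *\<^sub>R (v + s *\<^sub>R d) + r *\<^sub>R (v + t *\<^sub>R - d)"
        unfolding r by simp
      then show "v = (1 - s / (s + t)) *\<^sub>R (v + s *\<^sub>R d) + (s / (s + t)) *\<^sub>R (v + t *\<^sub>R - d)"
        unfolding r_def .
    qed
    then show False using ex s t unfolding extreme_point_of_def by blast
  qed
  obtain e :: "3 \<Rightarrow> 'a set" where e: "bij_betw e UNIV A"
    using finite_same_card_bij[of "UNIV :: 3 set" A] finA card3 unfolding A_def by auto
  define \<Phi> where "\<Phi> = (\<lambda>x. (\<chi> i. a (e i) \<bullet> x) :: real^3)"
  have lin: "linear \<Phi>" unfolding \<Phi>_def
    by (rule linearI) (auto simp: vec_eq_iff inner_add_right)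
  have injL: "inj_on \<Phi> L"
  proof (rule inj_onI)
    fix x y assume xy: "x \<in> L" "y \<in> L" "\<Phi> x = \<Phi> y"
    have "x - y = 0"
    proof (rule inj0)
      show "x - y \<in> L" using xy subL by (simp add: subspace_diff)
      fix f assume "f \<in> A"
      then obtain i where "f = e i" using e by (auto simp: bij_betw_def)
      then show "a f \<bullet> (x - y) = 0" using xy(3) unfolding \<Phi>_def by (simp add: vec_eq_iff inner_diff_right)
    qed
    then show "x = y" by simp
  qed
  have spanL: "span L = L" using subL by simp
  have "dim (\<Phi> ` L) = 3"
    using dim_image_eq[OF lin, of L] injL dimL unfolding spanL by simp
  then have "span (\<Phi> ` L) = UNIV" using dim_eq_full[of "\<Phi> ` L"] by simp
  moreover have "span (\<Phi> ` L) = \<Phi> ` L"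
    using linear_subspace_image[OF lin subL] by simp
  ultimately have surj: "\<Phi> ` L = UNIV" by simp
  have "\<exists>u\<in>L. \<forall>g\<in>A. a g \<bullet> u = (if g = f then -1 else 0)" if f: "f \<in> A" for f
  proof -
    obtain u where u: "u \<in> L" "\<Phi> u = (\<chi> i. if e i = f then -1 else 0)"
      using surj by (metis UNIV_I image_iff)
    have "a g \<bullet> u = (if g = f then -1 else 0)" if g: "g \<in> A" for g
    proof -
      obtain i where "g = e i" using e g unfolding bij_betw_def by blast
      then show ?thesis using u(2) unfolding \<Phi>_def by (simp add: vec_eq_iff)
    qed
    then show ?thesis using u by blast
  qed
  then obtain u where u: "\<And>f. f \<in> A \<Longrightarrow> u f \<in> L"
    "\<And>f g. f \<in> A \<Longrightarrow> g \<in> A \<Longrightarrow> a g \<bullet> u f = (if g = f then -1 else 0)"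
    by metis
  have cone: "x - v = (\<Sum>f\<in>A. (b f - a f \<bullet> x) *\<^sub>R u f)" if x: "x \<in> P" for x
  proof -
    have "x - v - (\<Sum>f\<in>A. (b f - a f \<bullet> x) *\<^sub>R u f) = 0"
    proof (rule inj0)
      show "x - v - (\<Sum>f\<in>A. (b f - a f \<bullet> x) *\<^sub>R u f) \<in> L"
        by (intro subspace_diff[OF subL inL[OF x]] subspace_sum[OF subL] subspace_scale[OF subL] u(1))
      fix g assume g: "g \<in> A"
      have "a g \<bullet> (\<Sum>f\<in>A. (b f - a f \<bullet> x) *\<^sub>R u f) = (\<Sum>f\<in>A. if g = f then a f \<bullet> x - b f else 0)"
        unfolding inner_sum_right by (intro sum.cong) (auto simp: u(2) g)
      also have "\<dots> = a g \<bullet> x - b g" using g finA by simp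
      finally show "a g \<bullet> (x - v - (\<Sum>f\<in>A. (b f - a f \<bullet> x) *\<^sub>R u f)) = 0"
        using Afac(2)[OF g] by (simp add: inner_diff_right)
    qed
    then show ?thesis by simp
  qed
  have nbr: "\<exists>w\<in>vertices P. \<exists>s>0. w = v + s *\<^sub>R u f" if f: "f \<in> A" for f
  proof -
    define E where "E = \<Inter>(insert P (A - {f}))"
    have Eface: "E face_of P" unfolding E_def
    proof (rule face_of_Inter)
      fix T assume "T \<in> insert P (A - {f})"
      then show "T face_of P"
        using facet_of_imp_face_of polytope_imp_convex[OF poly] unfolding A_def facets_def
        by (auto simp: face_of_refl)
    qed simp
    have memE: "x \<in> E \<longleftrightarrow> x \<in> P \<and> (\<forall>g\<in>A. g \<noteq> f \<longrightarrow> a g \<bullet> x = b g)" for x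
      unfolding E_def using memA by auto
    obtain t where t: "t > 0" "v + t *\<^sub>R u f \<in> P"
      using feas[of "u f"] u f by (metis le_minus_one_simps(1) order_refl)
    have tE: "v + t *\<^sub>R u f \<in> E"
      unfolding memE using t u(2)[OF f] Afac(2) by (auto simp: inner_add_right)
    have uf0: "u f \<noteq> 0" using u(2)[OF f f] by auto
    have "compact E" "convex E"
      using Eface poly by (auto intro: face_of_imp_compact face_of_imp_convex polytope_imp_convex polytope_imp_compact)
    then have KM: "E = convex hull {x. x extreme_point_of E}"
      by (rule Krein_Milman_Minkowski)
    \<comment> \<open>An edge is more than the point \<open>v\<close>, so by Krein--Milman it has a second extreme point.\<close>
    have "\<exists>w. w extreme_point_of E \<and> w \<noteq> v"
    proof (rule ccontr)
      assume "\<not> ?thesis"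
      then have "{x. x extreme_point_of E} \<subseteq> {v}" by auto
      then have "E \<subseteq> convex hull {v}" using KM hull_mono by metis
      then show False using tE t uf0 by auto
    qed
    then obtain w where w: "w extreme_point_of E" "w \<noteq> v" by blast
    have wE: "w \<in> E" using w by (simp add: extreme_point_of_def)
    then have wP: "w \<in> P" using memE by simp
    have "w - v = (\<Sum>g\<in>A. (b g - a g \<bullet> w) *\<^sub>R u g)" by (rule cone[OF wP])
    also have "\<dots> = (\<Sum>g\<in>A. if g = f then (b f - a f \<bullet> w) *\<^sub>R u f else 0)"
      using wE unfolding memE by (intro sum.cong) auto
    also have "\<dots> = (b f - a f \<bullet> w) *\<^sub>R u f" using f finA by simp
    finally have eq: "w - v = (b f - a f \<bullet> w) *\<^sub>R u f" .
    have "0 \<le> b f - a f \<bullet> w" using wP ab Afac(1)[OF f] by simp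
    moreover have "b f - a f \<bullet> w \<noteq> 0" using eq w(2) by auto
    moreover have "w \<in> vertices P"
      using w extreme_point_of_face[OF Eface] unfolding vertices_def by simp
    ultimately show ?thesis using eq by (intro bexI[of _ w] exI[of _ "b f - a f \<bullet> w"]) (auto simp: algebra_simps)
  qed
  then obtain w s where w: "\<And>f. f \<in> A \<Longrightarrow> w f \<in> vertices P"
    and s: "\<And>f. f \<in> A \<Longrightarrow> s f > 0" and ws: "\<And>f. f \<in> A \<Longrightarrow> w f = v + s f *\<^sub>R u f"
    by metis
  have sne: "s f \<noteq> 0" if "f \<in> A" for f using s[OF that] by simp
  have "edge_cone P v w (\<lambda>f x. (b f - a f \<bullet> x) / s f)"
    unfolding edge_cone_def
  proof (intro conjI ballI impI)
    fix f assume "f \<in> facets P" "v \<in> f"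
    then have f: "f \<in> A" unfolding A_def by simp
    show "w f \<in> vertices P" using w f .
    have wfP: "w f \<in> P" using w[OF f] unfolding vertices_def extreme_point_of_def by simp
    show "w f \<in> g \<longleftrightarrow> f \<noteq> g" if "g \<in> facets P" "v \<in> g" for g
    proof -
      have g: "g \<in> A" using that unfolding A_def by simp
      have "a g \<bullet> w f = b g + s f * (if g = f then -1 else 0)"
        unfolding ws[OF f] using u(2)[OF f g] Afac(2)[OF g] by (simp add: inner_add_right)
      then show ?thesis using memA[OF g] wfP s[OF f] by auto
    qed
    fix x assume x: "x \<in> P"
    show "0 \<le> (b f - a f \<bullet> x) / s f" using ab x Afac(1)[OF f] s[OF f] by simp
    show "(b f - a f \<bullet> x) / s f = 0 \<longleftrightarrow> x \<in> f"
      using memA[OF f, of x] x sne[OF f] by auto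
  next
    fix x assume x: "x \<in> P"
    have "(\<Sum>f\<in>A. ((b f - a f \<bullet> x) / s f) *\<^sub>R (w f - v)) = (\<Sum>f\<in>A. (b f - a f \<bullet> x) *\<^sub>R u f)"
      using sne by (intro sum.cong) (simp_all add: ws)
    then show "x - v = (\<Sum>f\<in>{f \<in> facets P. v \<in> f}. ((b f - a f \<bullet> x) / s f) *\<^sub>R (w f - v))"
      using cone[OF x] unfolding A_def by simp
  qed
  then show ?thesis by blast
qed

section \<open>Connectivity of the edge graph and Euler's formula\<close>

text \<open>
  The functionals that identify two given points form a hyperplane, and finitely many hyperplanes do not
  cover the space.
\<close>

lemma finite_inj_on_linear_functional:
  fixes X :: "'a::euclidean_space set"
  assumes "finite X"
  obtains c where "inj_on (\<lambda>x. c \<bullet> x) X"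
proof -
  define D where "D = {x - y | x y. x \<in> X \<and> y \<in> X \<and> x \<noteq> y}"
  have "D \<subseteq> (\<lambda>(x, y). x - y) ` (X \<times> X)" unfolding D_def by auto
  then have finD: "finite D" using assms by (meson finite_SigmaI finite_imageI finite_subset)
  have "negligible (\<Union>d\<in>D. {x. d \<bullet> x = 0})"
    using finD by (intro negligible_Union) (auto simp: D_def intro!: negligible_hyperplane)
  then have "(\<Union>d\<in>D. {x. d \<bullet> x = 0}) \<noteq> UNIV"
    using non_negligible_UNIV by metis
  then obtain c where c: "\<And>d. d \<in> D \<Longrightarrow> d \<bullet> c \<noteq> 0" by blast
  have "inj_on (\<lambda>x. c \<bullet> x) X"
  proof (rule inj_onI, rule ccontr)
    fix x y assume xy: "x \<in> X" "y \<in> X" "c \<bullet> x = c \<bullet> y" "x \<noteq> y"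
    then have "x - y \<in> D" unfolding D_def by blast
    then show False using c[of "x - y"] xy(3) by (simp add: inner_diff_right inner_commute[of _ c])
  qed
  then show ?thesis by (rule that)
qed

lemma simple_3_polytope_finite:
  assumes "simple_3_polytope P"
  shows "finite (facets P)" "finite (vertices P)"
proof -
  have "polyhedron P"
    using assms polytope_imp_polyhedron unfolding simple_3_polytope_def by blast
  then show "finite (facets P)" "finite (vertices P)"
    unfolding facets_def vertices_def
    by (rule finite_polyhedron_facets, rule finite_polyhedron_extreme_points)
qed

lemma face_minimum_at_vertex:
  fixes P :: "'a::euclidean_space set"
  assumes P: "polytope P" and F: "F face_of P" "F \<noteq> {}"
  shows "\<exists>v\<in>vertices P. v \<in> F \<and> (\<forall>x\<in>F. c \<bullet> v \<le> c \<bullet> x)"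
proof -
  have F': "compact F" "convex F"
    using P F by (auto intro: face_of_imp_compact face_of_imp_convex polytope_imp_convex polytope_imp_compact)
  have "continuous_on F (\<lambda>x. c \<bullet> x)" by (intro continuous_intros)
  then have "\<exists>y\<in>F. \<forall>x\<in>F. c \<bullet> y \<le> c \<bullet> x"
    by (rule continuous_attains_inf[OF F'(1) F(2)])
  then obtain y where y: "y \<in> F" "\<And>x. x \<in> F \<Longrightarrow> c \<bullet> y \<le> c \<bullet> x" by auto
  define G where "G = F \<inter> {x. c \<bullet> x = c \<bullet> y}"
  have G: "G face_of F" unfolding G_def
    using y(2) F'(2) by (intro face_of_Int_supporting_hyperplane_ge) auto
  have "compact G" "convex G" "y \<in> G"
    using G F' y by (auto intro: face_of_imp_compact face_of_imp_convex simp: G_def)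
  then obtain v where v: "v extreme_point_of G"
    using extreme_point_exists_convex by blast
  then have "v \<in> G" by (simp add: extreme_point_of_def)
  moreover have "v \<in> vertices P"
    using v extreme_point_of_face[OF G] extreme_point_of_face[OF F(1)] unfolding vertices_def by simp
  ultimately show ?thesis using y(2) by (intro bexI[of _ v]) (auto simp: G_def)
qed

text \<open>
  Connectivity of the edge graph, as a principle for functions that do not change along edges: the premise on \<open>w\<close> says
  that it lies on the edge at \<open>v\<close> that leaves \<open>f\<close>.  From a vertex that is not the lowest one for a generic functional, some edge leads
  down, since the polytope lies in the cone spanned by the edges.
\<close>

lemma simple_3_polytope_connected:
  fixes P :: "'a::euclidean_space set"
  assumes P: "simple_3_polytope P"
    and step: "\<And>v w f. v \<in> vertices P \<Longrightarrow> w \<in> vertices P \<Longrightarrow> f \<in> facets P \<Longrightarrow> v \<in> f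
      \<Longrightarrow> (\<And>g. g \<in> facets P \<Longrightarrow> v \<in> g \<Longrightarrow> g \<noteq> f \<Longrightarrow> w \<in> g) \<Longrightarrow> s v = s w"
    and "v \<in> vertices P" "v' \<in> vertices P"
  shows "s v = s v'"
proof -
  have poly: "polytope P" using P unfolding simple_3_polytope_def by simp
  have fin: "finite (vertices P)" using simple_3_polytope_finite[OF P] by simp
  have vP: "x \<in> P" if "x \<in> vertices P" for x
    using that unfolding vertices_def extreme_point_of_def by simp
  obtain c where inj: "inj_on (\<lambda>x. c \<bullet> x) (vertices P)"
    using finite_inj_on_linear_functional[OF fin] .
  have "P face_of P" using poly polytope_imp_convex face_of_refl by blast
  moreover have "P \<noteq> {}" using assms(3) vP by blast
  ultimately have "\<exists>v\<in>vertices P. v \<in> P \<and> (\<forall>x\<in>P. c \<bullet> v \<le> c \<bullet> x)"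
    by (rule face_minimum_at_vertex[OF poly])
  then obtain z where z: "z \<in> vertices P" "\<And>x. x \<in> P \<Longrightarrow> c \<bullet> z \<le> c \<bullet> x"
    by auto
  have "s x = s z" if "x \<in> vertices P" for x
    using that
  proof (induction "card {y \<in> vertices P. c \<bullet> y < c \<bullet> x}" arbitrary: x rule: less_induct)
    case less
    show ?case
    proof (cases "x = z")
      case False
      obtain w lam where "edge_cone P x w lam"
        using simple_polytope_edge_cone[OF P less.prems] by blast
      note w = edge_coneD[OF this]
      have "c \<bullet> z \<noteq> c \<bullet> x" using inj z(1) less.prems False by (auto dest: inj_onD)
      then have zx: "c \<bullet> z < c \<bullet> x" using z(2)[OF vP[OF less.prems]] by simp
      have "\<exists>f\<in>facets P. x \<in> f \<and> c \<bullet> w f < c \<bullet> x"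
      proof (rule ccontr)
        assume *: "\<not> ?thesis"
        have "c \<bullet> (z - x) = (\<Sum>f\<in>{f \<in> facets P. x \<in> f}. lam f z * (c \<bullet> (w f - x)))"
          unfolding w(5)[OF vP[OF z(1)]] inner_sum_right by simp
        also have "\<dots> \<ge> 0" using * w(3) vP[OF z(1)]
          by (intro sum_nonneg mult_nonneg_nonneg) (auto simp: inner_diff_right not_less)
        finally show False using zx by (simp add: inner_diff_right)
      qed
      then obtain f where f: "f \<in> facets P" "x \<in> f" "c \<bullet> w f < c \<bullet> x" by blast
      have "{y \<in> vertices P. c \<bullet> y < c \<bullet> w f} \<subset> {y \<in> vertices P. c \<bullet> y < c \<bullet> x}"
        using f w(1)[OF f(1,2)] by force
      then have "card {y \<in> vertices P. c \<bullet> y < c \<bullet> w f} < card {y \<in> vertices P. c \<bullet> y < c \<bullet> x}"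
        using fin by (intro psubset_card_mono) auto
      then have "s (w f) = s z" using less.hyps w(1)[OF f(1,2)] by blast
      moreover have "s x = s (w f)"
        using step[OF less.prems w(1)[OF f(1,2)] f(1,2)] w(2) f by blast
      ultimately show ?thesis by simp
    qed simp
  qed
  then show ?thesis using assms by metis
qed

text \<open>
  A vertex is lowest in \<open>P\<close>, or in one of its facets, iff all edges there that stay in that face go up.  So if
  \<open>o\<close> of the three edges at \<open>v\<close> go up, \<open>v\<close> is the lowest vertex of \<open>o choose 2\<close> facets and the highest one of
  \<open>(3 - o) choose 2\<close> facets.  The sum is \<open>1\<close> for \<open>o = 1, 2\<close> and \<open>3\<close> for \<open>o = 0, 3\<close>.
\<close>

lemma simple_3_polytope_vertex_local_minima:
  fixes P :: "'a::euclidean_space set"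
  assumes P: "simple_3_polytope P" and v: "v \<in> vertices P"
    and inj: "inj_on (\<lambda>x. c \<bullet> x) (vertices P)"
  shows "card {f \<in> facets P. v \<in> f \<and> (\<forall>x\<in>f. c \<bullet> v \<le> c \<bullet> x)}
       + card {f \<in> facets P. v \<in> f \<and> (\<forall>x\<in>f. c \<bullet> x \<le> c \<bullet> v)}
       = 1 + 2 * of_bool (\<forall>x\<in>P. c \<bullet> v \<le> c \<bullet> x) + 2 * of_bool (\<forall>x\<in>P. c \<bullet> x \<le> c \<bullet> v)"
proof -
  obtain w lam where "edge_cone P v w lam"
    using simple_polytope_edge_cone[OF P v] by blast
  note w = edge_coneD[OF this]
  have vP: "x \<in> P" if "x \<in> vertices P" for x
    using that unfolding vertices_def extreme_point_of_def by simp
  have facP: "x \<in> P" if "f \<in> facets P" "x \<in> f" for f x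
    using that facet_of_imp_subset unfolding facets_def by blast
  define A where "A = {f \<in> facets P. v \<in> f}"
  have "card A = 3" using P v unfolding simple_3_polytope_def A_def by simp
  then obtain f1 f2 f3 where A: "A = {f1, f2, f3}" and ne: "f1 \<noteq> f2" "f1 \<noteq> f3" "f2 \<noteq> f3"
    using card_3_iff by metis
  have memA: "f \<in> facets P \<and> v \<in> f" if "f \<in> A" for f using that unfolding A_def by simp
  have cone: "c \<bullet> x - c \<bullet> v = (\<Sum>f\<in>A. lam f x * (c \<bullet> w f - c \<bullet> v))" if "x \<in> P" for x
  proof -
    have "c \<bullet> (x - v) = c \<bullet> (\<Sum>f\<in>A. lam f x *\<^sub>R (w f - v))"
      using w(5)[OF that] unfolding A_def by simp
    then show ?thesis by (simp add: inner_sum_right inner_diff_right)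
  qed
  have wne: "c \<bullet> w f \<noteq> c \<bullet> v" if "f \<in> A" for f
    using w(1,2)[of f] memA[OF that] inj v by (metis inj_onD)
  define up where "up f \<longleftrightarrow> c \<bullet> v < c \<bullet> w f" for f
  have mnP: "(\<forall>x\<in>P. c \<bullet> v \<le> c \<bullet> x) \<longleftrightarrow> (\<forall>f\<in>A. up f)"
  proof
    assume "\<forall>x\<in>P. c \<bullet> v \<le> c \<bullet> x"
    then show "\<forall>f\<in>A. up f" unfolding up_def using wne w(1) vP memA by (metis order_le_less)
  next
    assume *: "\<forall>f\<in>A. up f"
    have "(\<Sum>f\<in>A. lam f x * (c \<bullet> w f - c \<bullet> v)) \<ge> 0" if "x \<in> P" for x
      using * w(3) that memA unfolding up_def by (intro sum_nonneg mult_nonneg_nonneg) (auto intro: less_imp_le)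
    then show "\<forall>x\<in>P. c \<bullet> v \<le> c \<bullet> x" using cone by (metis diff_ge_0_iff_ge)
  qed
  have mxP: "(\<forall>x\<in>P. c \<bullet> x \<le> c \<bullet> v) \<longleftrightarrow> (\<forall>f\<in>A. \<not> up f)"
  proof
    assume "\<forall>x\<in>P. c \<bullet> x \<le> c \<bullet> v"
    then show "\<forall>f\<in>A. \<not> up f" unfolding up_def using w(1) vP memA by (meson not_le)
  next
    assume *: "\<forall>f\<in>A. \<not> up f"
    have "(\<Sum>f\<in>A. lam f x * (c \<bullet> w f - c \<bullet> v)) \<le> 0" if "x \<in> P" for x
      using * w(3) that memA unfolding up_def by (intro sum_nonpos mult_nonneg_nonpos) (auto simp: not_less)
    then show "\<forall>x\<in>P. c \<bullet> x \<le> c \<bullet> v" using cone by (metis diff_le_0_iff_le)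
  qed
  have mnf: "(\<forall>x\<in>f. c \<bullet> v \<le> c \<bullet> x) \<longleftrightarrow> (\<forall>g\<in>A. g \<noteq> f \<longrightarrow> up g)" if f: "f \<in> A" for f
  proof
    assume "\<forall>x\<in>f. c \<bullet> v \<le> c \<bullet> x"
    then show "\<forall>g\<in>A. g \<noteq> f \<longrightarrow> up g" unfolding up_def using wne w(2) memA f by (metis order_le_less)
  next
    assume *: "\<forall>g\<in>A. g \<noteq> f \<longrightarrow> up g"
    show "\<forall>x\<in>f. c \<bullet> v \<le> c \<bullet> x"
    proof
      fix x assume x: "x \<in> f"
      then have xP: "x \<in> P" using facP memA f by blast
      have "(\<Sum>g\<in>A. lam g x * (c \<bullet> w g - c \<bullet> v)) \<ge> 0"
      proof (rule sum_nonneg)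
        fix g assume g: "g \<in> A"
        show "0 \<le> lam g x * (c \<bullet> w g - c \<bullet> v)"
          using w(3)[of g x] w(4)[of f x] * memA f g x xP unfolding up_def by (cases "g = f") auto
      qed
      then show "c \<bullet> v \<le> c \<bullet> x" using cone[OF xP] by simp
    qed
  qed
  have mxf: "(\<forall>x\<in>f. c \<bullet> x \<le> c \<bullet> v) \<longleftrightarrow> (\<forall>g\<in>A. g \<noteq> f \<longrightarrow> \<not> up g)" if f: "f \<in> A" for f
  proof
    assume "\<forall>x\<in>f. c \<bullet> x \<le> c \<bullet> v"
    then show "\<forall>g\<in>A. g \<noteq> f \<longrightarrow> \<not> up g" unfolding up_def using w(2) memA f by (metis not_le)
  next
    assume *: "\<forall>g\<in>A. g \<noteq> f \<longrightarrow> \<not> up g"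
    show "\<forall>x\<in>f. c \<bullet> x \<le> c \<bullet> v"
    proof
      fix x assume x: "x \<in> f"
      then have xP: "x \<in> P" using facP memA f by blast
      have "(\<Sum>g\<in>A. lam g x * (c \<bullet> w g - c \<bullet> v)) \<le> 0"
      proof (rule sum_nonpos)
        fix g assume g: "g \<in> A"
        show "lam g x * (c \<bullet> w g - c \<bullet> v) \<le> 0"
          using w(3)[of g x] w(4)[of f x] * memA f g x xP unfolding up_def
          by (cases "g = f") (auto simp: not_less mult_nonneg_nonpos)
      qed
      then show "c \<bullet> x \<le> c \<bullet> v" using cone[OF xP] by simp
    qed
  qed
  have minset: "{f \<in> facets P. v \<in> f \<and> (\<forall>x\<in>f. c \<bullet> v \<le> c \<bullet> x)} = {f \<in> A. \<forall>g\<in>A. g \<noteq> f \<longrightarrow> up g}"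
    using mnf memA unfolding A_def by blast
  have maxset: "{f \<in> facets P. v \<in> f \<and> (\<forall>x\<in>f. c \<bullet> x \<le> c \<bullet> v)} = {f \<in> A. \<forall>g\<in>A. g \<noteq> f \<longrightarrow> \<not> up g}"
    using mxf memA unfolding A_def by blast
  have cnt: "card {f \<in> A. Q f} = of_bool (Q f1) + of_bool (Q f2) + of_bool (Q f3)" for Q
  proof -
    have "card {f \<in> A. Q f} = (\<Sum>f\<in>A. of_bool (Q f))"
      using \<open>card A = 3\<close> by (subst sum_of_bool_eq) (auto simp: Int_def card_ge_0_finite)
    then show ?thesis using ne by (simp add: A)
  qed
  have allA: "(\<forall>g\<in>A. R g) \<longleftrightarrow> R f1 \<and> R f2 \<and> R f3" for R unfolding A by simp
  show ?thesis
    unfolding minset maxset mnP mxP cnt allA using ne by (cases "up f1"; cases "up f2"; cases "up f3") simp_all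
qed

text \<open>
  Every facet has one lowest and one highest vertex, so the sum over all vertices of the local count
  is twice the number of facets.  The two extreme vertices of \<open>P\<close> contribute \<open>2\<close> extra each.
\<close>

lemma simple_3_polytope_euler:
  fixes P :: "'a::euclidean_space set"
  assumes P: "simple_3_polytope P"
  shows "2 * card (facets P) = card (vertices P) + 4"
proof -
  have poly: "polytope P" and dim: "aff_dim P = 3" using P unfolding simple_3_polytope_def by auto
  have fin: "finite (facets P)" "finite (vertices P)" using simple_3_polytope_finite[OF P] by simp_all
  have vP: "x \<in> P" if "x \<in> vertices P" for x
    using that unfolding vertices_def extreme_point_of_def by simp
  have PP: "P face_of P" using poly polytope_imp_convex face_of_refl by blast
  have "P \<noteq> {}" using dim by auto
  obtain c where inj: "inj_on (\<lambda>x. c \<bullet> x) (vertices P)"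
    using finite_inj_on_linear_functional[OF fin(2)] .
  have one: "(\<Sum>v\<in>vertices P. of_bool (v \<in> F \<and> (\<forall>x\<in>F. c \<bullet> v \<le> c \<bullet> x))) = (1::nat)"
    "(\<Sum>v\<in>vertices P. of_bool (v \<in> F \<and> (\<forall>x\<in>F. c \<bullet> x \<le> c \<bullet> v))) = (1::nat)"
    if F: "F face_of P" "F \<noteq> {}" for F
  proof -
    obtain v where v: "v \<in> vertices P" "v \<in> F" "\<And>x. x \<in> F \<Longrightarrow> c \<bullet> v \<le> c \<bullet> x"
      using face_minimum_at_vertex[OF poly F] by blast
    have "y = v" if "y \<in> vertices P" "y \<in> F" "\<forall>x\<in>F. c \<bullet> y \<le> c \<bullet> x" for y
      using that v by (intro inj_onD[OF inj]) (auto intro: antisym)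
    then have "y \<in> F \<and> (\<forall>x\<in>F. c \<bullet> y \<le> c \<bullet> x) \<longleftrightarrow> y = v" if "y \<in> vertices P" for y
      using that v by blast
    then have "(\<Sum>y\<in>vertices P. of_bool (y \<in> F \<and> (\<forall>x\<in>F. c \<bullet> y \<le> c \<bullet> x))) = (\<Sum>y\<in>vertices P. of_bool (y = v) :: nat)"
      by (intro sum.cong refl) (simp only:)
    then show "(\<Sum>v\<in>vertices P. of_bool (v \<in> F \<and> (\<forall>x\<in>F. c \<bullet> v \<le> c \<bullet> x))) = (1::nat)" using v fin by (simp add: of_bool_def)
    obtain v where v: "v \<in> vertices P" "v \<in> F" "\<And>x. x \<in> F \<Longrightarrow> c \<bullet> x \<le> c \<bullet> v"
      using face_minimum_at_vertex[OF poly F, of "- c"] by auto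
    have "y = v" if "y \<in> vertices P" "y \<in> F" "\<forall>x\<in>F. c \<bullet> x \<le> c \<bullet> y" for y
      using that v by (intro inj_onD[OF inj]) (auto intro: antisym)
    then have "y \<in> F \<and> (\<forall>x\<in>F. c \<bullet> x \<le> c \<bullet> y) \<longleftrightarrow> y = v" if "y \<in> vertices P" for y
      using that v by blast
    then have "(\<Sum>y\<in>vertices P. of_bool (y \<in> F \<and> (\<forall>x\<in>F. c \<bullet> x \<le> c \<bullet> y))) = (\<Sum>y\<in>vertices P. of_bool (y = v) :: nat)"
      by (intro sum.cong refl) (simp only:)
    then show "(\<Sum>v\<in>vertices P. of_bool (v \<in> F \<and> (\<forall>x\<in>F. c \<bullet> x \<le> c \<bullet> v))) = (1::nat)" using v fin by (simp add: of_bool_def)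
  qed
  have facet: "f face_of P" "f \<noteq> {}" if "f \<in> facets P" for f
    using that unfolding facets_def facet_of_def by auto
  have "2 * card (facets P) = (\<Sum>f\<in>facets P. \<Sum>v\<in>vertices P.
      of_bool (v \<in> f \<and> (\<forall>x\<in>f. c \<bullet> v \<le> c \<bullet> x)) + of_bool (v \<in> f \<and> (\<forall>x\<in>f. c \<bullet> x \<le> c \<bullet> v)))"
    by (simp add: sum.distrib one facet)
  also have "\<dots> = (\<Sum>v\<in>vertices P. \<Sum>f\<in>facets P.
      of_bool (v \<in> f \<and> (\<forall>x\<in>f. c \<bullet> v \<le> c \<bullet> x)) + of_bool (v \<in> f \<and> (\<forall>x\<in>f. c \<bullet> x \<le> c \<bullet> v)))"
    by (rule sum.swap)
  also have "\<dots> = (\<Sum>v\<in>vertices P. card {f \<in> facets P. v \<in> f \<and> (\<forall>x\<in>f. c \<bullet> v \<le> c \<bullet> x)}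
       + card {f \<in> facets P. v \<in> f \<and> (\<forall>x\<in>f. c \<bullet> x \<le> c \<bullet> v)})"
    using fin(1) by (intro sum.cong) (auto simp: sum.distrib sum_of_bool_eq Int_def)
  also have "\<dots> = (\<Sum>v\<in>vertices P. 1 + 2 * of_bool (v \<in> P \<and> (\<forall>x\<in>P. c \<bullet> v \<le> c \<bullet> x))
      + 2 * of_bool (v \<in> P \<and> (\<forall>x\<in>P. c \<bullet> x \<le> c \<bullet> v)))"
    by (intro sum.cong) (simp_all add: simple_3_polytope_vertex_local_minima[OF P _ inj] vP)
  also have "\<dots> = card (vertices P) + 2 + 2"
    unfolding sum.distrib sum_distrib_left[symmetric] one[OF PP \<open>P \<noteq> {}\<close>] by simp
  finally show ?thesis by simp
qed

section \<open>Weights on the facets that vanish around every vertex\<close>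

lemma simple_3_polytope_facets_share_edge:
  fixes P :: "'a::euclidean_space set"
  assumes P: "simple_3_polytope P" and v: "v \<in> vertices P"
    and f: "f \<in> facets P" "v \<in> f" and g: "g \<in> facets P" "v \<in> g" and "f \<noteq> g"
  shows "(f \<inter> g) edge_of P"
proof -
  obtain w lam where "edge_cone P v w lam"
    using simple_polytope_edge_cone[OF P v] by blast
  note w = edge_coneD[OF this]
  have face: "f face_of P" "g face_of P"
    using f g facet_of_imp_face_of unfolding facets_def by auto
  define A where "A = {f \<in> facets P. v \<in> f}"
  have "card A = 3" using P v unfolding simple_3_polytope_def A_def by simp
  moreover have "f \<in> A" "g \<in> A" using f g unfolding A_def by auto
  ultimately have "card (A - {f, g}) = 1"
    using \<open>f \<noteq> g\<close> by (subst card_Diff_subset) auto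
  then obtain h where h: "A - {f, g} = {h}" by (rule card_1_singletonE)
  then have A: "A = {f, g, h}" and hA: "h \<in> facets P" "v \<in> h" "h \<noteq> f" "h \<noteq> g"
    using \<open>f \<in> A\<close> \<open>g \<in> A\<close> unfolding A_def by auto
  have wfg: "w h \<in> f \<inter> g" using w(2)[OF hA(1,2)] f g hA by blast
  have wv: "w h \<noteq> v" using w(2)[OF hA(1,2) hA(1,2)] hA by blast
  have "f \<inter> g \<subseteq> affine hull {v, w h}"
  proof
    fix x assume x: "x \<in> f \<inter> g"
    then have xP: "x \<in> P" using face face_of_imp_subset by blast
    have "lam f x = 0" "lam g x = 0" using w(4) f g x xP by auto
    then have "x - v = lam h x *\<^sub>R (w h - v)"
      using w(5)[OF xP] \<open>f \<noteq> g\<close> hA unfolding A_def[symmetric] A by simp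
    then have "x = (1 - lam h x) *\<^sub>R v + lam h x *\<^sub>R w h" by (simp add: algebra_simps)
    then have "\<exists>s t. x = s *\<^sub>R v + t *\<^sub>R w h \<and> s + t = 1"
      by (intro exI[of _ "1 - lam h x"] exI[of _ "lam h x"] conjI) simp_all
    then show "x \<in> affine hull {v, w h}" unfolding affine_hull_2 by blast
  qed
  then have "aff_dim (f \<inter> g) \<le> 1"
    using aff_dim_subset[of "f \<inter> g" "affine hull {v, w h}"] wv by (simp add: aff_dim_affine_hull)
  moreover have "aff_dim (f \<inter> g) \<ge> 1"
    using aff_dim_subset[of "{v, w h}" "f \<inter> g"] wfg f g wv by simp
  ultimately show ?thesis
    using face_of_Int[OF face] unfolding edge_of_def by simp
qed

lemma facet_coloring_at_vertex:
  fixes P :: "'a::euclidean_space set"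
  assumes P: "simple_3_polytope P" and col: "facet_3_coloring P col" and v: "v \<in> vertices P"
  shows "bij_betw col {f \<in> facets P. v \<in> f} {1, 2, 3}"
proof -
  have inj: "inj_on col {f \<in> facets P. v \<in> f}"
  proof (rule inj_onI, rule ccontr)
    fix f g assume "f \<in> {f \<in> facets P. v \<in> f}" "g \<in> {f \<in> facets P. v \<in> f}" "col f = col g" "f \<noteq> g"
    then show False
      using simple_3_polytope_facets_share_edge[OF P v, of f g] col
      unfolding facet_3_coloring_def by blast
  qed
  have "card {f \<in> facets P. v \<in> f} = 3" using P v unfolding simple_3_polytope_def by simp
  then have "card (col ` {f \<in> facets P. v \<in> f}) = card {1, 2, 3::nat}"
    using inj by (simp add: card_image)
  moreover have "col ` {f \<in> facets P. v \<in> f} \<subseteq> {1, 2, 3}"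
    using col unfolding facet_3_coloring_def by blast
  ultimately have "col ` {f \<in> facets P. v \<in> f} = {1, 2, 3}"
    by (intro card_subset_eq) auto
  then show ?thesis using inj by (simp add: bij_betw_def)
qed

text \<open>
  Let \<open>F v i\<close> be the facet of colour \<open>i\<close> at \<open>v\<close>.  Along an edge in the two facets of the other colours, these two are kept,
  so the condition at both ends forces the weights of the third facets, which have the same colour, to agree.
  By connectivity the weight of \<open>F v i\<close> depends on \<open>i\<close> only.
\<close>

lemma facet_weights_vanishing_at_vertices:
  fixes P :: "'a::euclidean_space set" and c :: "'a set \<Rightarrow> real"
  assumes P: "simple_3_polytope P" and col: "facet_3_coloring P col"
  shows "(\<forall>v\<in>vertices P. (\<Sum>f\<in>{f \<in> facets P. v \<in> f}. c f) = 0) \<longleftrightarrow>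
    (\<exists>k. (\<forall>f\<in>facets P. c f = k (col f)) \<and> k 1 + k 2 + k 3 = 0)" (is "?L \<longleftrightarrow> ?R")
proof
  assume ?R
  then obtain k where k: "\<And>f. f \<in> facets P \<Longrightarrow> c f = k (col f)" "k 1 + k 2 + k 3 = 0" by blast
  show ?L
  proof
    fix v assume v: "v \<in> vertices P"
    have "(\<Sum>f\<in>{f \<in> facets P. v \<in> f}. c f) = (\<Sum>f\<in>{f \<in> facets P. v \<in> f}. k (col f))"
      using k by (intro sum.cong) auto
    also have "\<dots> = sum k {1, 2, 3}"
      by (rule sum.reindex_bij_betw[OF facet_coloring_at_vertex[OF P col v]])
    finally show "(\<Sum>f\<in>{f \<in> facets P. v \<in> f}. c f) = 0" using k(2) by simp
  qed
next
  assume L: ?L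
  define F where "F v i = the_inv_into {f \<in> facets P. v \<in> f} col i" for v i
  have F: "F v i \<in> facets P" "v \<in> F v i" "col (F v i) = i"
    if "v \<in> vertices P" "i \<in> {1, 2, 3}" for v i
  proof -
    note bij = facet_coloring_at_vertex[OF P col that(1)]
    then have *: "inj_on col {f \<in> facets P. v \<in> f}" "i \<in> col ` {f \<in> facets P. v \<in> f}"
      using that(2) unfolding bij_betw_def by auto
    show "col (F v i) = i" unfolding F_def by (rule f_the_inv_into_f[OF *])
    show "F v i \<in> facets P" "v \<in> F v i"
      using the_inv_into_into[OF * subset_refl] unfolding F_def by auto
  qed
  have Feq: "F v (col f) = f" if "v \<in> vertices P" "f \<in> facets P" "v \<in> f" for v f
    using that facet_coloring_at_vertex[OF P col that(1)]
    unfolding F_def bij_betw_def by (intro the_inv_into_f_f) auto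
  have colr: "col f \<in> {1, 2, 3}" if "f \<in> facets P" for f
    using col that unfolding facet_3_coloring_def by blast
  have sum3: "c (F v 1) + c (F v 2) + c (F v 3) = 0" if v: "v \<in> vertices P" for v
  proof -
    have "(\<Sum>f\<in>{f \<in> facets P. v \<in> f}. c f) = (\<Sum>f\<in>{f \<in> facets P. v \<in> f}. c (F v (col f)))"
      using Feq v by (intro sum.cong) auto
    also have "\<dots> = (\<Sum>i\<in>{1, 2, 3}. c (F v i))"
      by (rule sum.reindex_bij_betw[OF facet_coloring_at_vertex[OF P col v]])
    finally show ?thesis using L v by simp
  qed
  have step: "(\<lambda>i\<in>{1, 2, 3}. c (F v i)) = (\<lambda>i\<in>{1, 2, 3}. c (F w i))"
    if v: "v \<in> vertices P" and w: "w \<in> vertices P" and f: "f \<in> facets P" "v \<in> f"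
      and nb: "\<And>g. g \<in> facets P \<Longrightarrow> v \<in> g \<Longrightarrow> g \<noteq> f \<Longrightarrow> w \<in> g" for v w f
  proof -
    have other: "c (F v i) = c (F w i)" if i: "i \<in> {1, 2, 3}" "i \<noteq> col f" for i
    proof -
      have "F v i \<noteq> f" using F[OF v i(1)] i by auto
      then have "w \<in> F v i" using nb F[OF v i(1)] by blast
      then have "F w (col (F v i)) = F v i" using Feq[OF w] F[OF v i(1)] by blast
      then show ?thesis using F(3)[OF v i(1)] by simp
    qed
    have "c (F v i) = c (F w i)" if i: "i \<in> {1, 2, 3}" for i
    proof (cases "i = col f")
      case True
      have "col f = 1 \<or> col f = 2 \<or> col f = 3" using colr[OF f(1)] by simp
      then show ?thesis using other[of 1] other[of 2] other[of 3] sum3[OF v] sum3[OF w] True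
        by (elim disjE) simp_all
    qed (use other i in blast)
    then show ?thesis by (rule restrict_ext)
  qed
  obtain v0 where v0: "v0 \<in> vertices P"
  proof -
    have "polytope P" "P \<noteq> {}" using P unfolding simple_3_polytope_def by auto
    \<comment> \<open>The zero functional is minimal everywhere: only the existence of a vertex matters here.\<close>
    then have "\<exists>v\<in>vertices P. v \<in> P \<and> (\<forall>x\<in>P. 0 \<bullet> v \<le> 0 \<bullet> x)"
      by (intro face_minimum_at_vertex) (auto simp: face_of_refl polytope_imp_convex)
    then show ?thesis using that by blast
  qed
  define k where "k i = c (F v0 i)" for i
  have "c f = k (col f)" if f: "f \<in> facets P" for f
  proof -
    have "polytope P" using P unfolding simple_3_polytope_def by auto
    then have "\<exists>v\<in>vertices P. v \<in> f \<and> (\<forall>x\<in>f. 0 \<bullet> v \<le> 0 \<bullet> x)"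
      using f by (intro face_minimum_at_vertex) (auto simp: facets_def facet_of_def)
    then obtain v where v: "v \<in> vertices P" "v \<in> f" by blast
    have "(\<lambda>i\<in>{1, 2, 3}. c (F v i)) = (\<lambda>i\<in>{1, 2, 3}. c (F v0 i))"
      by (rule simple_3_polytope_connected[OF P step v(1) v0])
    from fun_cong[OF this, of "col f"] have "c (F v (col f)) = c (F v0 (col f))"
      by (simp only: restrict_apply'[OF colr[OF f]])
    then show ?thesis using Feq[OF v(1) f v(2)] unfolding k_def by simp
  qed
  moreover have "k 1 + k 2 + k 3 = 0" unfolding k_def by (rule sum3[OF v0])
  ultimately show ?R by (intro exI[of _ k]) blast
qed

section \<open>Point configurations with a single affine relation\<close>

lemma convex_hull_image_iff:
  fixes p :: "'i \<Rightarrow> 'e::real_vector"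
  assumes "finite I" "J \<subseteq> I"
  shows "x \<in> convex hull (p ` J) \<longleftrightarrow>
    (\<exists>u. (\<forall>i\<in>I. 0 \<le> u i) \<and> (\<forall>i\<in>I - J. u i = 0) \<and> sum u I = 1 \<and> (\<Sum>i\<in>I. u i *\<^sub>R p i) = x)"
  (is "_ \<longleftrightarrow> ?R x")
proof
  have finJ: "finite J" using assms finite_subset by blast
  assume "?R x"
  then obtain u where u: "\<forall>i\<in>I. 0 \<le> u i" "\<forall>i\<in>I - J. u i = 0" "sum u I = 1" "(\<Sum>i\<in>I. u i *\<^sub>R p i) = x"
    by blast
  have "sum u J = 1" using u(2,3) sum.mono_neutral_left[OF assms, of u] by simp
  moreover have "(\<Sum>i\<in>J. u i *\<^sub>R p i) = x"
    using u(2,4) sum.mono_neutral_left[OF assms, of "\<lambda>i. u i *\<^sub>R p i"] by simp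
  moreover have "(\<Sum>i\<in>J. u i *\<^sub>R p i) \<in> convex hull (p ` J)"
    using finJ \<open>sum u J = 1\<close> u(1) assms(2) by (intro convex_sum) (auto intro: hull_inc)
  ultimately show "x \<in> convex hull (p ` J)" by simp
next
  have finJ: "finite J" using assms finite_subset by blast
  assume x: "x \<in> convex hull (p ` J)"
  have "convex hull (p ` J) \<subseteq> {x. ?R x}"
  proof (rule hull_minimal)
    show "p ` J \<subseteq> {x. ?R x}"
    proof (rule image_subsetI, rule CollectI)
      fix j assume j: "j \<in> J"
      then have jI: "j \<in> I" using assms by blast
      show "?R (p j)"
      proof (intro exI[of _ "\<lambda>i. if i = j then 1 else 0"] conjI)
        have "(\<Sum>i\<in>I. (if i = j then 1 else 0) *\<^sub>R p i) = (\<Sum>i\<in>I. if i = j then p i else 0)"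
          by (intro sum.cong) auto
        then show "(\<Sum>i\<in>I. (if i = j then 1 else 0) *\<^sub>R p i) = p j" using jI assms(1) by simp
      qed (use j jI assms(1) in auto)
    qed
    show "convex {x. ?R x}"
    proof (rule convexI, rule CollectI)
      fix x y s t assume xy: "x \<in> {x. ?R x}" "y \<in> {x. ?R x}" and st: "0 \<le> (s::real)" "0 \<le> t" "s + t = 1"
      from xy(1) obtain u where u: "\<forall>i\<in>I. 0 \<le> u i" "\<forall>i\<in>I - J. u i = 0" "sum u I = 1"
        "(\<Sum>i\<in>I. u i *\<^sub>R p i) = x" by blast
      from xy(2) obtain u' where u': "\<forall>i\<in>I. 0 \<le> u' i" "\<forall>i\<in>I - J. u' i = 0" "sum u' I = 1"
        "(\<Sum>i\<in>I. u' i *\<^sub>R p i) = y" by blast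
      show "?R (s *\<^sub>R x + t *\<^sub>R y)"
      proof (intro exI[of _ "\<lambda>i. s * u i + t * u' i"] conjI ballI)
        show "(\<Sum>i\<in>I. s * u i + t * u' i) = 1"
          using u(3) u'(3) st by (simp add: sum.distrib flip: sum_distrib_left)
        show "(\<Sum>i\<in>I. (s * u i + t * u' i) *\<^sub>R p i) = s *\<^sub>R x + t *\<^sub>R y"
          unfolding u(4)[symmetric] u'(4)[symmetric]
          by (simp add: scaleR_add_left sum.distrib scaleR_sum_right)
      qed (use u u' st in auto)
    qed
  qed
  then show "?R x" using x by blast
qed

lemma affine_hull_image_iff:
  fixes p :: "'i \<Rightarrow> 'e::real_vector"
  assumes "finite I" "inj_on p I"
  shows "x \<in> affine hull (p ` I) \<longleftrightarrow> (\<exists>u. sum u I = 1 \<and> (\<Sum>i\<in>I. u i *\<^sub>R p i) = x)"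
proof -
  have "x \<in> affine hull (p ` I) \<longleftrightarrow>
      (\<exists>u. sum u (p ` I) = 1 \<and> (\<Sum>v\<in>p ` I. u v *\<^sub>R v) = x)"
    using affine_hull_finite[of "p ` I"] assms(1) by auto
  also have "\<dots> \<longleftrightarrow> (\<exists>u. sum (u \<circ> p) I = 1 \<and> (\<Sum>i\<in>I. (u \<circ> p) i *\<^sub>R p i) = x)"
    using assms(2) by (simp add: sum.reindex o_def)
  also have "\<dots> \<longleftrightarrow> (\<exists>u. sum u I = 1 \<and> (\<Sum>i\<in>I. u i *\<^sub>R p i) = x)"
  proof
    assume "\<exists>u. sum u I = 1 \<and> (\<Sum>i\<in>I. u i *\<^sub>R p i) = x"
    then obtain u where u: "sum u I = 1" "(\<Sum>i\<in>I. u i *\<^sub>R p i) = x" by blast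
    define u' where "u' = (\<lambda>x. u (the_inv_into I p x))"
    have "(u' \<circ> p) i = u i" if "i \<in> I" for i
      using that assms(2) unfolding u'_def by (simp add: the_inv_into_f_f)
    then show "\<exists>u. sum (u \<circ> p) I = 1 \<and> (\<Sum>i\<in>I. (u \<circ> p) i *\<^sub>R p i) = x"
      using u by (intro exI[of _ u']) simp
  qed blast
  finally show ?thesis .
qed

lemma exists_other:
  assumes "2 \<le> card A"
  shows "\<exists>i\<in>A. i \<noteq> k"
proof (rule ccontr)
  assume "\<not> ?thesis"
  then have "A \<subseteq> {k}" by blast
  then have "card A \<le> card {k}" by (intro card_mono) auto
  then show False using assms by simp
qed

text \<open>
  Gale's criterion on the line: the values of \<open>w\<close> outside \<open>J\<close> have the origin in the relative interior of their convex
  hull iff they include both signs or are all zero; the case that no value is left belongs to the whole polytope.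
\<close>

definition gale_face :: "'i set \<Rightarrow> ('i \<Rightarrow> real) \<Rightarrow> 'i set \<Rightarrow> bool" where
  "gale_face I w J \<longleftrightarrow> J \<subseteq> I \<and>
     (\<not> {i \<in> I. 0 < w i} \<subseteq> J \<and> \<not> {i \<in> I. w i < 0} \<subseteq> J \<or> {i \<in> I. w i \<noteq> 0} \<subseteq> J)"

text \<open>
  The weight \<open>w\<close> is a Gale transform of the points \<open>p\<close>.  Having two entries of each sign makes all points
  distinct vertices of their convex hull.
\<close>

locale gale_line =
  fixes I :: "'i set" and p :: "'i \<Rightarrow> 'e::euclidean_space" and w :: "'i \<Rightarrow> real"
  assumes fin: "finite I"
    and relations: "\<And>c. sum c I = 0 \<and> (\<Sum>i\<in>I. c i *\<^sub>R p i) = 0 \<longleftrightarrow> (\<exists>t. \<forall>i\<in>I. c i = t * w i)"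
    and two_pos: "2 \<le> card {i \<in> I. 0 < w i}"
    and two_neg: "2 \<le> card {i \<in> I. w i < 0}"
begin

lemma weights: "sum w I = 0" "(\<Sum>i\<in>I. w i *\<^sub>R p i) = 0"
proof -
  have "\<exists>t. \<forall>i\<in>I. w i = t * w i" by (rule exI[of _ 1]) simp
  then show "sum w I = 0" "(\<Sum>i\<in>I. w i *\<^sub>R p i) = 0"
    unfolding relations[of w, symmetric] by simp_all
qed

lemma uminus_gale_line: "gale_line I p (\<lambda>i. - w i)"
proof
  show "sum c I = 0 \<and> (\<Sum>i\<in>I. c i *\<^sub>R p i) = 0 \<longleftrightarrow> (\<exists>t. \<forall>i\<in>I. c i = t * - w i)" for c
    unfolding relations by (metis minus_minus mult_minus_left mult_minus_right)
qed (use fin two_pos two_neg in auto)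

lemma difference_of_combinations:
  assumes "sum u I = sum v I" "(\<Sum>i\<in>I. u i *\<^sub>R p i) = (\<Sum>i\<in>I. v i *\<^sub>R p i)"
  obtains t where "\<And>i. i \<in> I \<Longrightarrow> u i - v i = t * w i"
proof -
  have "\<exists>t. \<forall>i\<in>I. u i - v i = t * w i"
    using assms relations[of "\<lambda>i. u i - v i"]
    by (simp add: sum_subtractf scaleR_diff_left)
  then show ?thesis using that by blast
qed

text \<open>
  Otherwise \<open>p k\<close> minus a convex combination of other points would be a relation with just one positive entry,
  but every nonzero multiple of \<open>w\<close> has two.
\<close>

lemma point_in_hull_iff:
  assumes J: "J \<subseteq> I" and k: "k \<in> I"
  shows "p k \<in> convex hull (p ` J) \<longleftrightarrow> k \<in> J"
proof
  assume "p k \<in> convex hull (p ` J)"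
  then obtain u where u: "\<forall>i\<in>I. 0 \<le> u i" "\<forall>i\<in>I - J. u i = 0" "sum u I = 1" "(\<Sum>i\<in>I. u i *\<^sub>R p i) = p k"
    unfolding convex_hull_image_iff[OF fin J] by blast
  define e where "e = (\<lambda>i. if i = k then 1 else 0::real)"
  have "(\<Sum>i\<in>I. e i *\<^sub>R p i) = (\<Sum>i\<in>I. if i = k then p i else 0)"
    unfolding e_def by (intro sum.cong) auto
  then have e: "sum e I = 1" "(\<Sum>i\<in>I. e i *\<^sub>R p i) = p k"
    using k fin unfolding e_def by simp_all
  obtain t where t: "\<And>i. i \<in> I \<Longrightarrow> e i - u i = t * w i"
    using difference_of_combinations[of e u] e u by auto
  show "k \<in> J"
  proof (rule ccontr)
    assume "k \<notin> J"
    then have "t * w k = 1" using t[OF k] u(2) k by (simp add: e_def)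
    have le: "t * w i \<le> 0" if "i \<in> I" "i \<noteq> k" for i
    proof -
      have "t * w i = - u i" using t[OF that(1)] that(2) by (simp add: e_def)
      then show ?thesis using u(1) that(1) by simp
    qed
    consider "t > 0" | "t < 0" using \<open>t * w k = 1\<close> by (metis linorder_neqE_linordered_idom mult_zero_left zero_neq_one)
    then show False
    proof cases
      case 1
      obtain i where "i \<in> I" "0 < w i" "i \<noteq> k" using exists_other[OF two_pos] by blast
      then show False using le[of i] 1 by (simp add: mult_le_0_iff)
    next
      case 2
      obtain i where "i \<in> I" "w i < 0" "i \<noteq> k" using exists_other[OF two_neg] by blast
      then show False using le[of i] 2 by (simp add: mult_le_0_iff)
    qed
  qed
qed (simp add: hull_inc)

lemma inj_points: "inj_on p I"
proof (rule inj_onI)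
  fix i j assume "i \<in> I" "j \<in> I" "p i = p j"
  then show "i = j" using point_in_hull_iff[of "{j}" i] by simp
qed

lemma hull_subset_iff:
  assumes "J \<subseteq> I" "J' \<subseteq> I"
  shows "convex hull (p ` J) \<subseteq> convex hull (p ` J') \<longleftrightarrow> J \<subseteq> J'"
proof
  assume *: "convex hull (p ` J) \<subseteq> convex hull (p ` J')"
  show "J \<subseteq> J'"
  proof
    fix k assume "k \<in> J"
    then have "p k \<in> convex hull (p ` J')" using * by (auto intro: hull_inc)
    then show "k \<in> J'" using point_in_hull_iff[OF assms(2)] \<open>k \<in> J\<close> assms(1) by blast
  qed
qed (intro hull_mono image_mono)

lemma hull_eq_iff:
  assumes "J \<subseteq> I" "J' \<subseteq> I"
  shows "convex hull (p ` J) = convex hull (p ` J') \<longleftrightarrow> J = J'"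
  by (simp only: set_eq_subset hull_subset_iff[OF assms] hull_subset_iff[OF assms(2,1)])

lemma hull_indices:
  assumes "J \<subseteq> I"
  shows "{i \<in> I. p i \<in> convex hull (p ` J)} = J"
proof -
  have "i \<in> I \<and> p i \<in> convex hull (p ` J) \<longleftrightarrow> i \<in> J" for i
    using point_in_hull_iff[OF assms, of i] assms by blast
  then show ?thesis by simp
qed

text \<open>
  If a point of the hull of \<open>J\<close> lies between two points of the polytope, the two representations differ by some
  \<open>t * w\<close>, which is nonnegative outside \<open>J\<close>.  By the criterion it vanishes there, so both endpoints have no
  weight outside \<open>J\<close>.
\<close>

lemma gale_face_imp_face:
  assumes "gale_face I w J"
  shows "convex hull (p ` J) face_of convex hull (p ` I)"
proof -
  have J: "J \<subseteq> I" using assms unfolding gale_face_def by simp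
  show ?thesis
    unfolding face_of_def
  proof (intro conjI ballI impI)
    fix a b x assume a: "a \<in> convex hull (p ` I)" and b: "b \<in> convex hull (p ` I)"
      and x: "x \<in> convex hull (p ` J)" and seg: "x \<in> open_segment a b"
    obtain \<alpha> where \<alpha>: "\<forall>i\<in>I. 0 \<le> \<alpha> i" "sum \<alpha> I = 1" "(\<Sum>i\<in>I. \<alpha> i *\<^sub>R p i) = a"
      using a unfolding convex_hull_image_iff[OF fin subset_refl] by blast
    obtain \<beta> where \<beta>: "\<forall>i\<in>I. 0 \<le> \<beta> i" "sum \<beta> I = 1" "(\<Sum>i\<in>I. \<beta> i *\<^sub>R p i) = b"
      using b unfolding convex_hull_image_iff[OF fin subset_refl] by blast
    obtain \<gamma> where \<gamma>: "\<forall>i\<in>I. 0 \<le> \<gamma> i" "\<forall>i\<in>I - J. \<gamma> i = 0" "sum \<gamma> I = 1" "(\<Sum>i\<in>I. \<gamma> i *\<^sub>R p i) = x"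
      using x unfolding convex_hull_image_iff[OF fin J] by blast
    obtain r where r: "0 < r" "r < 1" "x = (1 - r) *\<^sub>R a + r *\<^sub>R b"
      using seg unfolding in_segment by blast
    define \<delta> where "\<delta> = (\<lambda>i. (1 - r) * \<alpha> i + r * \<beta> i)"
    have "sum \<delta> I = 1"
      using \<alpha>(2) \<beta>(2) unfolding \<delta>_def by (simp add: sum.distrib flip: sum_distrib_left)
    moreover have "(\<Sum>i\<in>I. \<delta> i *\<^sub>R p i) = x"
      unfolding r(3) \<alpha>(3)[symmetric] \<beta>(3)[symmetric] \<delta>_def
      by (simp add: scaleR_add_left sum.distrib scaleR_sum_right)
    ultimately obtain t where t: "\<And>i. i \<in> I \<Longrightarrow> \<delta> i - \<gamma> i = t * w i"
      using difference_of_combinations[of \<delta> \<gamma>] \<gamma> by auto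
    have \<delta>0: "0 \<le> \<delta> i" if "i \<in> I" for i
      using \<alpha>(1) \<beta>(1) r that unfolding \<delta>_def by simp
    have out: "t * w i \<ge> 0" if "i \<in> I" "i \<notin> J" for i
      using t[OF that(1)] \<delta>0[OF that(1)] \<gamma>(2) that by simp
    have zero: "t * w i = 0" if "i \<in> I" "i \<notin> J" for i
    proof (cases "{i \<in> I. w i \<noteq> 0} \<subseteq> J")
      case False
      then obtain j k where "j \<in> I" "0 < w j" "j \<notin> J" "k \<in> I" "w k < 0" "k \<notin> J"
        using assms unfolding gale_face_def by blast
      then have "t = 0" using out[of j] out[of k] by (simp add: zero_le_mult_iff)
      then show ?thesis by simp
    qed (use that in auto)
    have ab0: "\<alpha> i = 0 \<and> \<beta> i = 0" if "i \<in> I - J" for i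
    proof -
      have "(1 - r) * \<alpha> i + r * \<beta> i = 0"
        using t[of i] zero[of i] \<gamma>(2) that unfolding \<delta>_def by simp
      moreover have "0 \<le> (1 - r) * \<alpha> i" "0 \<le> r * \<beta> i" using r \<alpha>(1) \<beta>(1) that by simp_all
      ultimately have "(1 - r) * \<alpha> i = 0" "r * \<beta> i = 0" by linarith+
      then show ?thesis using r by simp
    qed
    show "a \<in> convex hull (p ` J)" "b \<in> convex hull (p ` J)"
      unfolding convex_hull_image_iff[OF fin J] using \<alpha> \<beta> ab0 by blast+
  qed (simp_all add: J hull_mono image_mono)
qed

text \<open>
  The relation \<open>w\<close> says that the weighted mean of the positive points equals that of the negative points, so a face with all
  positive points contains a point of the relative interior of the hull of the negative ones, and hence all of them.
\<close>

lemma face_with_positive_part: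
  assumes face: "convex hull (p ` J) face_of convex hull (p ` I)" and J: "J \<subseteq> I"
    and pos: "{i \<in> I. 0 < w i} \<subseteq> J"
  shows "{i \<in> I. w i < 0} \<subseteq> J"
proof
  fix k assume "k \<in> {i \<in> I. w i < 0}"
  then have k: "k \<in> I" "w k < 0" by auto
  \<comment> \<open>The positive and the negative part of \<open>w\<close>.\<close>
  define wp where "wp = (\<lambda>i. max (w i) 0)"
  define wn where "wn = (\<lambda>i. max (- w i) 0)"
  have w_eq: "w i = wp i - wn i" for i unfolding wp_def wn_def by auto
  have nn: "0 \<le> wp i" "0 \<le> wn i" for i unfolding wp_def wn_def by auto
  define s where "s = sum wn I"
  have sp: "sum wp I = s"
    using weights(1) unfolding s_def w_eq by (simp add: sum_subtractf)
  have pp: "(\<Sum>i\<in>I. wp i *\<^sub>R p i) = (\<Sum>i\<in>I. wn i *\<^sub>R p i)"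
    using weights(2) unfolding w_eq by (simp add: scaleR_diff_left sum_subtractf)
  have wnk: "0 < wn k" using k unfolding wn_def by simp
  obtain l where l: "l \<in> I" "w l < 0" "l \<noteq> k" using exists_other[OF two_neg] by blast
  define s' where "s' = sum wn (I - {k})"
  have "0 < wn l" using l unfolding wn_def by simp
  also have "wn l \<le> s'" unfolding s'_def using l fin nn by (intro member_le_sum) auto
  finally have s': "0 < s'" .
  have s_eq: "s = wn k + s'" unfolding s_def s'_def using fin k by (simp add: sum.remove)
  \<comment> \<open>The common mean \<open>x\<close> lies strictly between \<open>p k\<close> and the mean \<open>b\<close> of the other negative points.\<close>
  define x where "x = (\<Sum>i\<in>I. (wp i / s) *\<^sub>R p i)"
  define b where "b = (\<Sum>i\<in>I - {k}. (wn i / s') *\<^sub>R p i)"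
  have spos: "0 < s" using s_eq s' wnk by simp
  have xJ: "x \<in> convex hull (p ` J)"
    unfolding convex_hull_image_iff[OF fin J]
  proof (intro exI[of _ "\<lambda>i. wp i / s"] conjI ballI)
    show "wp i / s = 0" if "i \<in> I - J" for i using that pos unfolding wp_def by force
    show "(\<Sum>i\<in>I. wp i / s) = 1" using sp spos by (simp flip: sum_divide_distrib)
  qed (use nn spos in \<open>auto simp: x_def\<close>)
  have bk: "b \<in> convex hull (p ` (I - {k}))"
    unfolding convex_hull_image_iff[OF finite_Diff[OF fin] subset_refl]
  proof (intro exI[of _ "\<lambda>i. wn i / s'"] conjI ballI)
    show "(\<Sum>i\<in>I - {k}. wn i / s') = 1"
      using s' unfolding s'_def by (simp flip: sum_divide_distrib)
  qed (use nn s' in \<open>auto simp: b_def\<close>)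
  have bI: "b \<in> convex hull (p ` I)" using bk hull_mono[of "p ` (I - {k})" "p ` I"] by blast
  have kI: "p k \<in> convex hull (p ` I)" using k by (simp add: hull_inc)
  have "p k \<noteq> b" using bk point_in_hull_iff[of "I - {k}" k] k by auto
  have "s *\<^sub>R x = (\<Sum>i\<in>I. wp i *\<^sub>R p i)"
    unfolding x_def scaleR_sum_right using spos by simp
  also have "\<dots> = wn k *\<^sub>R p k + (\<Sum>i\<in>I - {k}. wn i *\<^sub>R p i)"
    unfolding pp using fin k by (simp add: sum.remove)
  also have "(\<Sum>i\<in>I - {k}. wn i *\<^sub>R p i) = s' *\<^sub>R b"
    unfolding b_def scaleR_sum_right using s' by simp
  finally have sx: "s *\<^sub>R x = wn k *\<^sub>R p k + s' *\<^sub>R b" .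
  have "x = (1 / s) *\<^sub>R (s *\<^sub>R x)" using spos by simp
  also have "\<dots> = (wn k / s) *\<^sub>R p k + (s' / s) *\<^sub>R b"
    unfolding sx by (simp add: scaleR_add_right)
  also have "wn k / s = 1 - s' / s" using s_eq spos by (simp add: field_simps)
  finally have "x = (1 - s' / s) *\<^sub>R p k + (s' / s) *\<^sub>R b" .
  then have "x \<in> open_segment (p k) b"
    unfolding in_segment using \<open>p k \<noteq> b\<close> s' s_eq wnk by (intro conjI exI[of _ "s' / s"]) auto
  then have "p k \<in> convex hull (p ` J)" using face kI bI xJ unfolding face_of_def by blast
  then show "k \<in> J" using point_in_hull_iff[OF J k(1)] by simp
qed

lemma face_iff_gale_face:
  assumes J: "J \<subseteq> I"
  shows "convex hull (p ` J) face_of convex hull (p ` I) \<longleftrightarrow> gale_face I w J"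
proof
  assume face: "convex hull (p ` J) face_of convex hull (p ` I)"
  have "{i \<in> I. 0 < w i} \<subseteq> J \<Longrightarrow> {i \<in> I. w i < 0} \<subseteq> J"
    using face_with_positive_part[OF face J] .
  moreover have "{i \<in> I. w i < 0} \<subseteq> J \<Longrightarrow> {i \<in> I. 0 < w i} \<subseteq> J"
    using gale_line.face_with_positive_part[OF uminus_gale_line face J] by simp
  moreover have "{i \<in> I. w i \<noteq> 0} = {i \<in> I. 0 < w i} \<union> {i \<in> I. w i < 0}" by auto
  ultimately show "gale_face I w J" unfolding gale_face_def using J by blast
qed (rule gale_face_imp_face)

lemma faces_eq: "{F. F face_of convex hull (p ` I)} = (\<lambda>J. convex hull (p ` J)) ` {J. gale_face I w J}"
proof (intro equalityI subsetI)
  fix F assume "F \<in> {F. F face_of convex hull (p ` I)}"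
  then have F: "F face_of convex hull (p ` I)" by simp
  have "compact (p ` I)" using fin by (simp add: finite_imp_compact)
  then obtain S where S: "S \<subseteq> p ` I" "F = convex hull S"
    using face_of_convex_hull_subset[OF _ F] by blast
  then obtain J where J: "J \<subseteq> I" "S = p ` J" by (meson subset_imageE)
  then have "gale_face I w J" using face_iff_gale_face F S by blast
  then show "F \<in> (\<lambda>J. convex hull (p ` J)) ` {J. gale_face I w J}" using S J by blast
qed (auto intro: gale_face_imp_face)

lemma vertices_hull: "vertices (convex hull (p ` I)) = p ` I"
proof (intro equalityI subsetI)
  fix x assume "x \<in> vertices (convex hull (p ` I))"
  then show "x \<in> p ` I" unfolding vertices_def using extreme_point_of_convex_hull by blast
next
  fix x assume "x \<in> p ` I"
  then obtain k where k: "k \<in> I" "x = p k" by blast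
  have "gale_face I w {k}"
    unfolding gale_face_def using k exists_other[OF two_pos, of k] exists_other[OF two_neg, of k] by blast
  then have "{p k} face_of convex hull (p ` I)" using gale_face_imp_face[of "{k}"] by simp
  then show "x \<in> vertices (convex hull (p ` I))"
    unfolding vertices_def k by (simp add: face_of_singleton)
qed

text \<open>
  Without a point of nonzero weight no relation is left, and that point lies in the affine hull of the others.
\<close>

lemma aff_dim_hull: "aff_dim (convex hull (p ` I)) = int (card I) - 2"
proof -
  obtain k where k: "k \<in> I" "0 < w k" using exists_other[OF two_pos] by blast
  define K where "K = I - {k}"
  have finK: "finite K" and inj: "inj_on p K" and I: "I = insert k K" and kK: "k \<notin> K"
    using fin inj_points k unfolding K_def by (auto intro: inj_on_subset)
  have indep: "\<not> affine_dependent (p ` K)"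
  proof
    assume "affine_dependent (p ` K)"
    then obtain U where U: "sum U (p ` K) = 0" "\<exists>v\<in>p ` K. U v \<noteq> 0" "(\<Sum>v\<in>p ` K. U v *\<^sub>R v) = 0"
      using affine_dependent_explicit_finite[of "p ` K"] finK by blast
    define c where "c = (\<lambda>i. if i = k then 0 else U (p i))"
    have cK: "c i = U (p i)" if "i \<in> K" for i using that kK unfolding c_def by auto
    have "sum c I = 0"
      using U(1) inj finK kK cK unfolding I by (simp add: sum.reindex c_def)
    moreover have "(\<Sum>i\<in>I. c i *\<^sub>R p i) = 0"
      using U(3) inj finK kK cK unfolding I by (simp add: sum.reindex c_def)
    ultimately obtain t where t: "\<forall>i\<in>I. c i = t * w i" using relations[of c] by blast
    then have "t = 0" using k unfolding c_def by auto
    then show False using U(2) t cK unfolding I by auto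
  qed
  have "p k \<in> affine hull (p ` K)"
    unfolding affine_hull_image_iff[OF finK inj]
  proof (intro exI conjI)
    have "w k + sum w K = 0" using weights(1) finK kK unfolding I by simp
    then have "sum w K = - w k" by linarith
    moreover have "(\<Sum>i\<in>K. - w i / w k) = - sum w K / w k"
      by (simp add: sum_negf sum_divide_distrib)
    ultimately show "(\<Sum>i\<in>K. - w i / w k) = 1" using k by simp
    have "w k *\<^sub>R p k + (\<Sum>i\<in>K. w i *\<^sub>R p i) = 0" using weights(2) finK kK unfolding I by simp
    then have *: "w k *\<^sub>R p k = - (\<Sum>i\<in>K. w i *\<^sub>R p i)" by (simp add: eq_neg_iff_add_eq_0)
    have "(\<Sum>i\<in>K. (- w i / w k) *\<^sub>R p i) = (1 / w k) *\<^sub>R - (\<Sum>i\<in>K. w i *\<^sub>R p i)"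
      unfolding scaleR_sum_right sum_negf[symmetric] by (intro sum.cong) auto
    also have "\<dots> = p k" unfolding *[symmetric] using k by simp
    finally show "(\<Sum>i\<in>K. (- w i / w k) *\<^sub>R p i) = p k" .
  qed
  then have "aff_dim (p ` I) = aff_dim (p ` K)" unfolding I by (simp add: aff_dim_insert)
  also have "\<dots> = int (card K) - 1"
    using aff_dim_affine_independent[OF indep] inj by (simp add: card_image)
  finally show ?thesis
    using finK kK unfolding I by (simp add: aff_dim_convex_hull)
qed

lemma restrict:
  assumes I': "I' \<subseteq> I" and zero: "\<And>i. i \<in> I - I' \<Longrightarrow> w i = 0"
  shows "gale_line I' p w"
proof
  show "finite I'" using fin I' finite_subset by blast
  have "{i \<in> I'. 0 < w i} = {i \<in> I. 0 < w i}" "{i \<in> I'. w i < 0} = {i \<in> I. w i < 0}"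
    using I' zero by force+
  then show "2 \<le> card {i \<in> I'. 0 < w i}" "2 \<le> card {i \<in> I'. w i < 0}"
    using two_pos two_neg by auto
  fix c :: "_ \<Rightarrow> real"
  define c' where "c' = (\<lambda>i. if i \<in> I' then c i else 0)"
  have "sum c' I = sum c I'"
    using sum.mono_neutral_left[OF fin I', of c'] unfolding c'_def by simp
  moreover have "(\<Sum>i\<in>I. c' i *\<^sub>R p i) = (\<Sum>i\<in>I'. c i *\<^sub>R p i)"
    using sum.mono_neutral_left[OF fin I', of "\<lambda>i. c' i *\<^sub>R p i"] unfolding c'_def by simp
  moreover have "(\<exists>t. \<forall>i\<in>I. c' i = t * w i) \<longleftrightarrow> (\<exists>t. \<forall>i\<in>I'. c i = t * w i)"
  proof (intro ex_cong1)
    fix t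
    have "t * w i = 0" if "i \<in> I - I'" for i using zero[OF that] by simp
    then show "(\<forall>i\<in>I. c' i = t * w i) \<longleftrightarrow> (\<forall>i\<in>I'. c i = t * w i)"
      using I' unfolding c'_def by (metis DiffI subsetD)
  qed
  ultimately show "sum c I' = 0 \<and> (\<Sum>i\<in>I'. c i *\<^sub>R p i) = 0 \<longleftrightarrow> (\<exists>t. \<forall>i\<in>I'. c i = t * w i)"
    using relations[of c'] by simp
qed

text \<open>
  Such a dependence would be a relation with coefficient \<open>1\<close> at \<open>a\<close>, where \<open>w\<close> vanishes.
\<close>

lemma apex_not_in_affine_hull:
  assumes a: "a \<in> I" and "w a = 0"
  shows "p a \<notin> affine hull (p ` (I - {a}))"
proof
  have finK: "finite (I - {a})" and inj: "inj_on p (I - {a})"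
    using fin inj_points by (auto intro: inj_on_subset)
  assume "p a \<in> affine hull (p ` (I - {a}))"
  then obtain u where u: "sum u (I - {a}) = 1" "(\<Sum>i\<in>I - {a}. u i *\<^sub>R p i) = p a"
    unfolding affine_hull_image_iff[OF finK inj] by blast
  define c where "c = (\<lambda>i. if i = a then 1 else - u i)"
  have "sum c I = 0"
    unfolding sum.remove[OF fin a] using u by (simp add: c_def sum_negf)
  moreover have "(\<Sum>i\<in>I. c i *\<^sub>R p i) = 0"
    unfolding sum.remove[OF fin a] using u by (simp add: c_def sum_negf)
  ultimately obtain t where "\<forall>i\<in>I. c i = t * w i" using relations[of c] by blast
  then show False using a assms(2) unfolding c_def by auto
qed

end

text \<open>
  The apexes are added one at a time: deleting a point of weight \<open>0\<close> leaves a configuration of the same kind.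
\<close>

lemma gale_line_fold_pyramid:
  assumes "finite A" "gale_line (B \<union> A) p w" "A \<inter> B = {}" "\<And>a. a \<in> A \<Longrightarrow> w a = 0"
  shows "is_fold_pyramid (card A) (int (card B + card A) - 2)
    (convex hull (p ` B)) (convex hull (p ` (B \<union> A)))"
  using assms
proof (induction A rule: finite_induct)
  case empty
  then interpret gale_line B p w by simp
  show ?case using aff_dim_hull fin by (simp add: polytope_convex_hull)
next
  case (insert a A)
  interpret big: gale_line "B \<union> insert a A" p w by (rule insert.prems(1))
  have a: "a \<notin> B \<union> A" using insert by auto
  have small: "gale_line (B \<union> A) p w"
    by (rule big.restrict) (use insert.prems(3) in auto)
  interpret small: gale_line "B \<union> A" p w by (rule small)
  have IH: "is_fold_pyramid (card A) (int (card B + card A) - 2)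
    (convex hull (p ` B)) (convex hull (p ` (B \<union> A)))"
    using insert.IH[OF small] insert.prems by auto
  have "card (B \<union> A) = card B + card A"
    using small.fin insert.prems(2) by (intro card_Un_disjoint) auto
  then have dim: "aff_dim (convex hull (p ` (B \<union> A))) = int (card B + card A) - 2"
    using small.aff_dim_hull by simp
  have "p a \<notin> affine hull (p ` ((B \<union> insert a A) - {a}))"
    using insert.prems(3) by (intro big.apex_not_in_affine_hull) auto
  also have "(B \<union> insert a A) - {a} = B \<union> A" using a by auto
  finally have apex: "p a \<notin> affine hull (convex hull (p ` (B \<union> A)))"
    by (simp add: affine_hull_convex_hull)
  have hull: "convex hull (p ` (B \<union> insert a A)) = convex hull (insert (p a) (convex hull (p ` (B \<union> A))))"
    by (metis Un_insert_right hull_insert image_insert)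
  have poly: "polytope (convex hull (p ` (B \<union> A)))" using small.fin by (simp add: polytope_convex_hull)
  show ?case
    using insert.hyps IH poly dim apex hull by (auto simp: is_pyramid_def intro!: exI[of _ "convex hull (p ` (B \<union> A))"])
qed

text \<open>
  In both configurations the faces are the hulls of the same index sets, ordered by inclusion of these sets.
\<close>

lemma gale_line_combinatorially_equivalent:
  fixes p :: "'i \<Rightarrow> 'e::euclidean_space" and q :: "'i \<Rightarrow> 'g::euclidean_space"
  assumes p: "gale_line I p w" and q: "gale_line I q w'"
    and sgn: "\<And>i. i \<in> I \<Longrightarrow> sgn (w i) = sgn (w' i)"
  shows "combinatorially_equivalent (convex hull (p ` I)) (convex hull (q ` I))"
proof -
  interpret p: gale_line I p w by (rule p)
  interpret q: gale_line I q w' by (rule q)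
  have "0 < w i \<longleftrightarrow> 0 < w' i" "w i < 0 \<longleftrightarrow> w' i < 0" "w i = 0 \<longleftrightarrow> w' i = 0" if "i \<in> I" for i
    using sgn[OF that] by (metis sgn_greater, metis sgn_less, metis sgn_0_0)
  then have same: "gale_face I w J \<longleftrightarrow> gale_face I w' J" for J
    unfolding gale_face_def by (simp cong: conj_cong)
  define \<phi> where "\<phi> = (\<lambda>F. convex hull (q ` {i \<in> I. p i \<in> F}))"
  have \<phi>: "\<phi> (convex hull (p ` J)) = convex hull (q ` J)" if "gale_face I w J" for J
    using p.hull_indices[of J] that unfolding \<phi>_def gale_face_def by simp
  have sub: "J \<subseteq> I" if "gale_face I w J" for J using that unfolding gale_face_def by simp
  have "bij_betw \<phi> {F. F face_of convex hull (p ` I)} {G. G face_of convex hull (q ` I)}"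
    unfolding bij_betw_def
  proof
    show "inj_on \<phi> {F. F face_of convex hull (p ` I)}"
      unfolding p.faces_eq by (rule inj_onI) (auto simp: \<phi> sub q.hull_eq_iff)
    show "\<phi> ` {F. F face_of convex hull (p ` I)} = {G. G face_of convex hull (q ` I)}"
      unfolding p.faces_eq q.faces_eq image_image by (intro image_cong) (auto simp: \<phi> same[symmetric])
  qed
  moreover have "F \<subseteq> F' \<longleftrightarrow> \<phi> F \<subseteq> \<phi> F'"
    if "F face_of convex hull (p ` I)" "F' face_of convex hull (p ` I)" for F F'
  proof -
    have "F \<in> (\<lambda>J. convex hull (p ` J)) ` {J. gale_face I w J}"
      "F' \<in> (\<lambda>J. convex hull (p ` J)) ` {J. gale_face I w J}"
      using that unfolding p.faces_eq[symmetric] by simp_all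
    then obtain J J' where J: "gale_face I w J" "F = convex hull (p ` J)"
      "gale_face I w J'" "F' = convex hull (p ` J')" by blast
    show ?thesis
      unfolding J(2,4) \<phi>[OF J(1)] \<phi>[OF J(3)]
      using p.hull_subset_iff q.hull_subset_iff sub[OF J(1)] sub[OF J(3)] by simp
  qed
  ultimately show ?thesis
    unfolding combinatorially_equivalent_def by (intro exI[of _ \<phi>] conjI allI impI)
qed

section \<open>The affine relation between points on the moment curve\<close>

text \<open>
  A relation between the moment vectors annihilates all polynomials of degree at most \<open>N - 2\<close>, in particular the one
  that vanishes at all nodes but \<open>a\<close> and \<open>b\<close>.
\<close>

lemma moment_relation_two_terms:
  fixes c :: "nat \<Rightarrow> real"
  assumes rel: "\<And>j. j \<le> N - 2 \<Longrightarrow> (\<Sum>k<N. c k * real k ^ j) = 0"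
    and ab: "a < N" "b < N" "a \<noteq> b"
  shows "c a * (\<Prod>s\<in>{..<N} - {a, b}. real a - real s)
       + c b * (\<Prod>s\<in>{..<N} - {a, b}. real b - real s) = 0"
proof -
  define S where "S = {..<N} - {a, b}"
  define q where "q = (\<Prod>s\<in>S. [:- real s, 1:])"
  have qx: "poly q x = (\<Prod>s\<in>S. x - real s)" for x
    unfolding q_def poly_prod by simp
  have finS: "finite S" and cardS: "card S = N - 2"
    using ab unfolding S_def by auto
  have "degree q \<le> (\<Sum>s\<in>S. degree [:- real s, 1:])"
    unfolding q_def using degree_prod_sum_le[OF finS, of "\<lambda>s. [:- real s, 1:]"] by (simp add: o_def)
  then have deg: "degree q \<le> N - 2" using cardS by simp
  have "(\<Sum>k<N. c k * poly q (real k)) = (\<Sum>k<N. \<Sum>j\<le>degree q. coeff q j * (c k * real k ^ j))"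
    unfolding poly_altdef sum_distrib_left by (intro sum.cong) auto
  also have "\<dots> = (\<Sum>j\<le>degree q. coeff q j * (\<Sum>k<N. c k * real k ^ j))"
    unfolding sum_distrib_left by (rule sum.swap)
  also have "\<dots> = 0" using rel deg by (intro sum.neutral) auto
  finally have "(\<Sum>k<N. c k * poly q (real k)) = 0" .
  also have "(\<Sum>k<N. c k * poly q (real k)) = (\<Sum>k\<in>{a, b}. c k * poly q (real k))"
  proof (rule sum.mono_neutral_right)
    show "\<forall>k\<in>{..<N} - {a, b}. c k * poly q (real k) = 0"
      using finS unfolding qx S_def[symmetric] by (auto intro: prod_zero)
  qed (use ab in auto)
  finally show ?thesis using ab(3) unfolding qx S_def by simp
qed

text \<open>
  The two products that belong to the neighbours \<open>k\<close> and \<open>k + 1\<close> have the same sign, because no other node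
  separates them; so the coefficients there have opposite signs.
\<close>

lemma moment_relation_alternates:
  fixes c :: "nat \<Rightarrow> real"
  assumes rel: "\<And>j. j \<le> N - 2 \<Longrightarrow> (\<Sum>k<N. c k * real k ^ j) = 0"
    and "0 < c 0" and "k < N"
  shows "0 < (- 1) ^ k * c k"
  using \<open>k < N\<close>
proof (induction k)
  case (Suc k)
  define S where "S = {..<N} - {k, Suc k}"
  define A where "A = (\<Prod>s\<in>S. real k - real s)"
  define B where "B = (\<Prod>s\<in>S. real (Suc k) - real s)"
  have rel2: "c k * A + c (Suc k) * B = 0"
    using moment_relation_two_terms[of N c k "Suc k"] rel Suc.prems unfolding A_def B_def S_def by simp
  have "A * B = (\<Prod>s\<in>S. (real k - real s) * (real (Suc k) - real s))"
    unfolding A_def B_def prod.distrib ..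
  also have "\<dots> > 0"
  proof (rule prod_pos)
    fix s assume "s \<in> S"
    then have "s < k \<or> Suc k < s" unfolding S_def by auto
    then show "0 < (real k - real s) * (real (Suc k) - real s)"
      by (auto intro: mult_pos_pos mult_neg_neg)
  qed
  finally have AB: "0 < A * B" .
  have "0 < (- 1) ^ k * c k" using Suc by simp
  then have "0 < ((- 1) ^ k * c k) * (A * B)" using AB by (rule mult_pos_pos)
  also have "\<dots> = (- 1) ^ k * (c k * A) * B" by (simp add: algebra_simps)
  also have "c k * A = - (c (Suc k) * B)" using rel2 by simp
  also have "(- 1) ^ k * - (c (Suc k) * B) * B = ((- 1) ^ Suc k * c (Suc k)) * (B * B)"
    by (simp add: algebra_simps)
  finally have "0 < ((- 1) ^ Suc k * c (Suc k)) * (B * B)" .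
  moreover have "0 \<le> B * B" by simp
  ultimately show ?case
    unfolding zero_less_mult_iff[of "(- 1) ^ Suc k * c (Suc k)"] by linarith
qed (use assms in simp)

text \<open>
  Subtracting a multiple of \<open>d\<close> makes the coefficient at \<open>0\<close> vanish, and by the two-term
  relations all the other coefficients vanish with it.
\<close>

lemma moment_relation_unique:
  fixes c d :: "nat \<Rightarrow> real"
  assumes c: "\<And>j. j \<le> N - 2 \<Longrightarrow> (\<Sum>k<N. c k * real k ^ j) = 0"
    and d: "\<And>j. j \<le> N - 2 \<Longrightarrow> (\<Sum>k<N. d k * real k ^ j) = 0"
    and d0: "d 0 \<noteq> 0" and k: "k < N"
  shows "c k = c 0 / d 0 * d k"
proof (cases "k = 0")
  case False
  define e where "e = (\<lambda>k. c k - c 0 / d 0 * d k)"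
  have "(\<Sum>k<N. e k * real k ^ j) = 0" if "j \<le> N - 2" for j
  proof -
    have "(\<Sum>k<N. e k * real k ^ j) = (\<Sum>k<N. c k * real k ^ j) - c 0 / d 0 * (\<Sum>k<N. d k * real k ^ j)"
      unfolding e_def sum_distrib_left sum_subtractf[symmetric] by (intro sum.cong) (auto simp: algebra_simps)
    then show ?thesis using c d that by simp
  qed
  from moment_relation_two_terms[OF this, of 0 k]
  have "e 0 * (\<Prod>s\<in>{..<N} - {0, k}. real 0 - real s) + e k * (\<Prod>s\<in>{..<N} - {0, k}. real k - real s) = 0"
    using k False by simp
  moreover have "e 0 = 0" unfolding e_def using d0 by simp
  moreover have "(\<Prod>s\<in>{..<N} - {0, k}. real k - real s) \<noteq> 0" by (subst prod_zero_iff) auto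
  ultimately show ?thesis unfolding e_def by simp
qed (use d0 in simp)

definition moment_point :: "(nat \<Rightarrow> 'a::euclidean_space) \<Rightarrow> nat \<Rightarrow> real \<Rightarrow> 'a" where
  "moment_point e d t = (\<Sum>k=1..d. (t ^ k) *\<^sub>R e k)"

lemma moment_point_inner:
  assumes "inj_on e A" "e ` A \<subseteq> Basis" "{1..d} \<subseteq> A" "i \<in> A"
  shows "moment_point e d t \<bullet> e i = (if i \<in> {1..d} then t ^ i else 0)"
proof -
  have "moment_point e d t \<bullet> e i = (\<Sum>k=1..d. if k = i then t ^ k else 0)"
    unfolding moment_point_def inner_sum_left
  proof (intro sum.cong)
    fix k assume "k \<in> {1..d}"
    then have k: "k \<in> A" using assms(3) by blast
    then have "e k \<in> Basis" "e i \<in> Basis" using assms(2,4) by blast+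
    then have "e k \<bullet> e i = (if k = i then 1 else 0)"
      using inj_on_eq_iff[OF assms(1) k assms(4)] by (simp add: inner_Basis)
    then show "(t ^ k) *\<^sub>R e k \<bullet> e i = (if k = i then t ^ k else 0)" by simp
  qed simp
  then show ?thesis by simp
qed

text \<open>
  \<open>N\<close> points in a space of dimension \<open>N - 2\<close> are affinely dependent.  Any nonzero relation has a nonzero coefficient at
  \<open>0\<close>, which is normalised to \<open>1\<close>.
\<close>

lemma moment_relation_exists:
  fixes e :: "nat \<Rightarrow> 'a::euclidean_space"
  assumes N: "3 \<le> N" and e: "inj_on e {1..N - 2}" "e ` {1..N - 2} \<subseteq> Basis"
  obtains d :: "nat \<Rightarrow> real" where "0 < d 0" "\<And>j. j \<le> N - 2 \<Longrightarrow> (\<Sum>k<N. d k * real k ^ j) = 0"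
proof -
  define \<mu> where "\<mu> = (\<lambda>k. moment_point e (N - 2) (real k))"
  have inner: "\<mu> k \<bullet> e i = real k ^ i" if "i \<in> {1..N - 2}" for i k
    using moment_point_inner[OF e subset_refl that] that unfolding \<mu>_def by simp
  have inj: "inj_on \<mu> {..<N}"
  proof (rule inj_onI)
    fix x y assume "\<mu> x = \<mu> y"
    then have "\<mu> x \<bullet> e 1 = \<mu> y \<bullet> e 1" by simp
    then show "x = y" using inner[of 1] N by simp
  qed
  have "\<mu> ` {..<N} \<subseteq> span (e ` {1..N - 2})"
    unfolding \<mu>_def moment_point_def by (intro image_subsetI span_sum span_scale span_base imageI)
  then have "dim (\<mu> ` {..<N}) \<le> card (e ` {1..N - 2})"
    by (intro dim_le_card) auto
  also have "\<dots> \<le> N - 2" using card_image_le[of "{1..N - 2}" e] by simp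
  finally have "affine_dependent (\<mu> ` {..<N})"
    using N inj by (intro affine_dependent_biggerset_general) (auto simp: card_image)
  then obtain U where U: "sum U (\<mu> ` {..<N}) = 0" "\<exists>v\<in>\<mu> ` {..<N}. U v \<noteq> 0"
    "(\<Sum>v\<in>\<mu> ` {..<N}. U v *\<^sub>R v) = 0"
    using affine_dependent_explicit_finite[of "\<mu> ` {..<N}"] by blast
  define c where "c = (\<lambda>k. U (\<mu> k))"
  have rel: "(\<Sum>k<N. c k * real k ^ j) = 0" if j: "j \<le> N - 2" for j
  proof (cases "j = 0")
    case True
    then show ?thesis using U(1) inj unfolding c_def by (simp add: sum.reindex)
  next
    case False
    have "(\<Sum>k<N. c k * real k ^ j) = (\<Sum>k<N. c k *\<^sub>R \<mu> k) \<bullet> e j"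
      using False j by (simp add: inner_sum_left inner)
    also have "(\<Sum>k<N. c k *\<^sub>R \<mu> k) = 0"
      using U(3) inj unfolding c_def by (simp add: sum.reindex)
    finally show ?thesis by simp
  qed
  have "c 0 \<noteq> 0"
  proof
    assume c0: "c 0 = 0"
    have "c k = 0" if k: "k < N" for k
    proof (cases "k = 0")
      case False
      have "c 0 * (\<Prod>s\<in>{..<N} - {0, k}. real 0 - real s) + c k * (\<Prod>s\<in>{..<N} - {0, k}. real k - real s) = 0"
        using moment_relation_two_terms[of N c 0 k] rel k False by simp
      moreover have "(\<Prod>s\<in>{..<N} - {0, k}. real k - real s) \<noteq> 0" by (subst prod_zero_iff) auto
      ultimately show ?thesis using c0 by simp
    qed (use c0 in simp)
    then show False using U(2) unfolding c_def by auto
  qed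
  define d where "d = (\<lambda>k. c k / c 0)"
  have "0 < d 0" unfolding d_def using \<open>c 0 \<noteq> 0\<close> by simp
  moreover have "(\<Sum>k<N. d k * real k ^ j) = 0" if "j \<le> N - 2" for j
    using rel[OF that] unfolding d_def by (simp flip: sum_divide_distrib)
  ultimately show ?thesis by (rule that)
qed

section \<open>Consequences for pyramids over cyclic polytopes\<close>

text \<open>
  The points of nonzero weight span a proper face, and they still satisfy the relation \<open>w\<close>, so this face
  has too many vertices for a simplex.
\<close>

lemma gale_line_not_simplicial:
  assumes "gale_line I p w" and zero: "\<exists>i\<in>I. w i = 0"
  shows "\<not> simplicial_polytope (convex hull (p ` I))"
proof
  interpret gale_line I p w by (rule assms(1))
  define J where "J = {i \<in> I. w i \<noteq> 0}"
  have J: "J \<subseteq> I" "J \<noteq> I" using zero unfolding J_def by auto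
  interpret J: gale_line J p w by (rule restrict) (auto simp: J_def)
  have "gale_face I w J" unfolding gale_face_def J_def by auto
  then have "proper_face_of (convex hull (p ` J)) (convex hull (p ` I))"
    unfolding proper_face_of_def using gale_face_imp_face hull_eq_iff[OF J(1) subset_refl] J(2) by simp
  moreover assume "simplicial_polytope (convex hull (p ` I))"
  ultimately obtain k where "k simplex (convex hull (p ` J))"
    unfolding simplicial_polytope_def by blast
  then obtain C where C: "\<not> affine_dependent C" "convex hull (p ` J) = convex hull C"
    unfolding simplex_def by blast
  have "vertices (convex hull C) = C"
    unfolding vertices_def using extreme_point_of_convex_hull_affine_independent[OF C(1)] by simp
  then have "C = p ` J" using J.vertices_hull C(2) by simp
  then have "card C = card J" using J.inj_points by (simp add: card_image)
  moreover have "aff_dim (convex hull C) = int (card C) - 1"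
    using aff_dim_affine_independent[OF C(1)] by (simp add: aff_dim_convex_hull)
  ultimately show False using J.aff_dim_hull C(2) by simp
qed

lemma gale_line_gale_transform:
  fixes p :: "'i::finite \<Rightarrow> 'e::euclidean_space"
  assumes "gale_line UNIV p w"
  shows "gale_transform p w"
proof -
  interpret gale_line UNIV p w by (rule assms)
  define x where "x = ((\<chi> j. w j) :: real^'i)"
  have "w \<noteq> (\<lambda>_. 0)" using two_pos by auto
  then have x0: "x \<noteq> 0" unfolding x_def by (auto simp: vec_eq_iff fun_eq_iff)
  have "c \<in> span {x} \<longleftrightarrow> c \<in> affine_relations p" for c
  proof -
    have "c \<in> span {x} \<longleftrightarrow> (\<exists>t. \<forall>i\<in>UNIV. c $ i = t * w i)"
      unfolding span_singleton x_def by (auto simp: vec_eq_iff)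
    then show ?thesis
      using relations[of "\<lambda>j. c $ j"] unfolding affine_relations_def by simp
  qed
  then have "span {x} = affine_relations p" by blast
  moreover have "independent {x}" using x0 by (simp add: dependent_single)
  ultimately show ?thesis
    unfolding gale_transform_def using aff_dim_hull by (simp add: x_def)
qed

text \<open>
  Positions on the moment curve at which the two sign classes alternate.
\<close>

lemma parity_bijection:
  assumes A: "finite A" "card A = m" and B: "finite B" "card B = m" and disj: "A \<inter> B = {}"
  shows "\<exists>h. bij_betw h (A \<union> B) {..<2 * m} \<and> (\<forall>i\<in>A. even (h i)) \<and> (\<forall>i\<in>B. odd (h i))"
proof -
  obtain f where f: "bij_betw f A {..<m}" using finite_same_card_bij[of A "{..<m}"] A by auto
  obtain g where g: "bij_betw g B {..<m}" using finite_same_card_bij[of B "{..<m}"] B by auto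
  define h where "h = (\<lambda>i. if i \<in> A then 2 * f i else Suc (2 * g i))"
  have hA: "h i = 2 * f i" "f i < m" if "i \<in> A" for i
    using that bij_betwE[OF f] unfolding h_def by auto
  have hB: "h i = Suc (2 * g i)" "g i < m" if "i \<in> B" for i
    using that disj bij_betwE[OF g] unfolding h_def by auto
  have inj: "inj_on h (A \<union> B)"
  proof (rule inj_onI)
    fix i j assume ij: "i \<in> A \<union> B" "j \<in> A \<union> B" "h i = h j"
    then have "even (h i) \<longleftrightarrow> even (h j)" by simp
    then consider "i \<in> A" "j \<in> A" | "i \<in> B" "j \<in> B" using ij(1,2) hA(1) hB(1) by force
    then show "i = j"
    proof cases
      case 1
      then show ?thesis using ij(3) hA(1) f by (auto simp: bij_betw_def dest: inj_onD)
    next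
      case 2
      then show ?thesis using ij(3) hB(1) g by (auto simp: bij_betw_def dest: inj_onD)
    qed
  qed
  have "h ` (A \<union> B) \<subseteq> {..<2 * m}" using hA hB by force
  moreover have "card (h ` (A \<union> B)) = card {..<2 * m}"
    using inj A B disj by (simp add: card_image card_Un_disjoint)
  ultimately have "h ` (A \<union> B) = {..<2 * m}" by (intro card_subset_eq) auto
  then show ?thesis using inj hA hB by (intro exI[of _ h]) (auto simp: bij_betw_def)
qed

text \<open>
  The indices of nonzero weight are placed on the moment curve in \<open>D = 2 * m - 2\<close> coordinates, the two signs
  alternating along it; each of the remaining indices gets a unit vector in a coordinate of its own.  In a relation
  the latter coordinates kill the weights of the unit vectors, and the former ones say that the remaining
  weights form a relation of the moment curve.
\<close>

lemma cyclic_pyramid_gale_line: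
  fixes w :: "'i \<Rightarrow> real"
  assumes fin: "finite I" and pos: "card {i \<in> I. 0 < w i} = m" and neg: "card {i \<in> I. w i < 0} = m"
    and m: "2 \<le> m" and dim: "card I \<le> DIM('a::euclidean_space) + 2"
  shows "\<exists>(q :: 'i \<Rightarrow> 'a) w'. gale_line I q w' \<and> (\<forall>i\<in>I. sgn (w i) = sgn (w' i)) \<and>
    is_cyclic_polytope (2 * m) (2 * m - 2) (convex hull (q ` {i \<in> I. w i \<noteq> 0}))"
proof -
  define N where "N = 2 * m"
  define D where "D = N - 2"
  define X where "X = {i \<in> I. w i \<noteq> 0}"
  define Z where "Z = {i \<in> I. w i = 0}"
  have IXZ: "I = X \<union> Z" "X \<inter> Z = {}" and finXZ: "finite X" "finite Z"
    using fin unfolding X_def Z_def by auto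
  have X_eq: "{i \<in> I. 0 < w i} \<union> {i \<in> I. w i < 0} = X" unfolding X_def by auto
  have "\<exists>h. bij_betw h X {..<N} \<and> (\<forall>i\<in>{i \<in> I. 0 < w i}. even (h i)) \<and> (\<forall>i\<in>{i \<in> I. w i < 0}. odd (h i))"
    unfolding X_eq[symmetric] N_def using fin pos neg by (intro parity_bijection) auto
  then obtain h where h: "bij_betw h X {..<N}"
    and even: "\<forall>i\<in>{i \<in> I. 0 < w i}. even (h i)"
    and odd: "\<forall>i\<in>{i \<in> I. w i < 0}. odd (h i)"
    by blast
  have hN: "h i < N" if "i \<in> X" for i using h that by (auto simp: bij_betw_def)
  have "card X = N" using h by (simp add: bij_betw_same_card)
  then have cardI: "card I = N + card Z" using IXZ finXZ by (simp add: card_Un_disjoint)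
  have "card {1..DIM('a)} = card (Basis :: 'a set)" by simp
  then obtain e :: "nat \<Rightarrow> 'a" where e: "bij_betw e {1..DIM('a)} Basis"
    using finite_same_card_bij[of "{1..DIM('a)}" "Basis :: 'a set"] by auto
  have einj: "inj_on e {1..DIM('a)}" and eB: "e ` {1..DIM('a)} = Basis" using e by (auto simp: bij_betw_def)
  have DD: "D + card Z \<le> DIM('a)" using dim m unfolding D_def cardI N_def by simp
  then have sub: "{1..D} \<subseteq> {1..DIM('a)}" by auto
  have "card Z = card {D + 1..D + card Z}" by simp
  then obtain z where z: "bij_betw z Z {D + 1..D + card Z}"
    using finite_same_card_bij[OF finXZ(2), of "{D + 1..D + card Z}"] by auto
  have zD: "z i \<in> {1..DIM('a)}" "D < z i" if "i \<in> Z" for i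
    using bij_betwE[OF z] that DD by force+
  have e_inner: "e i \<bullet> e j = (if i = j then 1 else 0)" if "i \<in> {1..DIM('a)}" "j \<in> {1..DIM('a)}" for i j
    using that eB inj_on_eq_iff[OF einj that] by (metis imageI inner_Basis)
  have esub: "inj_on e {1..D}" "e ` {1..D} \<subseteq> Basis"
    using einj eB sub by (auto intro: inj_on_subset)
  obtain d where d0: "0 < d 0" and d: "\<And>j. j \<le> D \<Longrightarrow> (\<Sum>k<N. d k * real k ^ j) = 0"
    using moment_relation_exists[of N e] esub m unfolding D_def N_def by auto
  define q where "q = (\<lambda>i. if w i \<noteq> 0 then moment_point e D (real (h i)) else e (z i))"
  \<comment> \<open>On the moment curve \<open>d\<close> is positive at even positions, which were given to the positive entries of \<open>w\<close>.\<close>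
  define w' where "w' = (\<lambda>i. if w i \<noteq> 0 then d (h i) else 0)"
  have qX: "q i \<bullet> e j = (if j \<le> D then real (h i) ^ j else 0)"
    if "i \<in> X" "j \<in> {1..DIM('a)}" for i j
    using moment_point_inner[OF einj _ sub that(2)] that eB unfolding q_def X_def by auto
  have qZ: "q i \<bullet> e j = (if z i = j then 1 else 0)" if "i \<in> Z" "j \<in> {1..DIM('a)}" for i j
    using e_inner[OF zD(1)[OF that(1)] that(2)] that(1) unfolding q_def Z_def by auto
  have sum_split: "sum g I = sum g X + sum g Z" for g :: "'i \<Rightarrow> real"
    unfolding IXZ(1) using IXZ(2) finXZ by (simp add: sum.union_disjoint)
  have reindex: "(\<Sum>i\<in>X. g (h i)) = (\<Sum>k<N. g k)" for g :: "nat \<Rightarrow> real"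
    by (rule sum.reindex_bij_betw[OF h])
  have inner_low: "(\<Sum>i\<in>I. c i *\<^sub>R q i) \<bullet> e j = (\<Sum>i\<in>X. c i * real (h i) ^ j)"
    if "j \<in> {1..D}" for c j
  proof -
    have j: "j \<in> {1..DIM('a)}" using that sub by blast
    have "(\<Sum>i\<in>Z. c i * (q i \<bullet> e j)) = 0"
      using zD(2) qZ j that by (intro sum.neutral) force
    moreover have "(\<Sum>i\<in>X. c i * (q i \<bullet> e j)) = (\<Sum>i\<in>X. c i * real (h i) ^ j)"
      using qX j that by (intro sum.cong) auto
    ultimately show ?thesis by (simp add: inner_sum_left sum_split)
  qed
  have inner_high: "(\<Sum>i\<in>I. c i *\<^sub>R q i) \<bullet> e j = (\<Sum>i\<in>Z. if z i = j then c i else 0)"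
    if "j \<in> {1..DIM('a)}" "D < j" for c j
  proof -
    have "(\<Sum>i\<in>X. c i * (q i \<bullet> e j)) = 0" using qX that by (intro sum.neutral) auto
    moreover have "(\<Sum>i\<in>Z. c i * (q i \<bullet> e j)) = (\<Sum>i\<in>Z. if z i = j then c i else 0)"
      using qZ that by (intro sum.cong) auto
    ultimately show ?thesis by (simp add: inner_sum_left sum_split)
  qed
  have alt: "0 < (- 1) ^ h i * d (h i)" if "i \<in> X" for i
    using moment_relation_alternates[of N d "h i"] d d0 hN[OF that] unfolding D_def by simp
  have sgn: "sgn (w i) = sgn (w' i)" if "i \<in> I" for i
  proof -
    consider "0 < w i" | "w i < 0" | "w i = 0" by linarith
    then show ?thesis
    proof cases
      case 1
      then show ?thesis using alt[of i] even that unfolding w'_def X_def by simp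
    next
      case 2
      then show ?thesis using alt[of i] odd that unfolding w'_def X_def by simp
    qed (simp add: w'_def)
  qed
  have line: "gale_line I q w'"
  proof
    have "0 < w i \<longleftrightarrow> 0 < w' i" "w i < 0 \<longleftrightarrow> w' i < 0" if "i \<in> I" for i
      using sgn[OF that] by (metis sgn_greater, metis sgn_less)
    then have "{i \<in> I. 0 < w' i} = {i \<in> I. 0 < w i}" "{i \<in> I. w' i < 0} = {i \<in> I. w i < 0}" by blast+
    then show "2 \<le> card {i \<in> I. 0 < w' i}" "2 \<le> card {i \<in> I. w' i < 0}"
      using pos neg m by simp_all
    show "finite I" by (rule fin)
    fix c :: "'i \<Rightarrow> real"
    show "sum c I = 0 \<and> (\<Sum>i\<in>I. c i *\<^sub>R q i) = 0 \<longleftrightarrow> (\<exists>t. \<forall>i\<in>I. c i = t * w' i)"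
    proof
      assume c: "sum c I = 0 \<and> (\<Sum>i\<in>I. c i *\<^sub>R q i) = 0"
      have cZ: "c a = 0" if a: "a \<in> Z" for a
      proof -
        have "0 = (\<Sum>i\<in>Z. if z i = z a then c i else 0)"
          using inner_high[OF zD[OF a], of c] c by simp
        also have "\<dots> = (\<Sum>i\<in>Z. if i = a then c i else 0)"
          using z a by (intro sum.cong) (auto simp: bij_betw_def dest: inj_onD)
        finally show ?thesis using a finXZ by simp
      qed
      define C where "C = (\<lambda>k. c (the_inv_into X h k))"
      have Ch: "C (h i) = c i" if "i \<in> X" for i
        using h that unfolding C_def bij_betw_def by (simp add: the_inv_into_f_f)
      have "(\<Sum>k<N. C k * real k ^ j) = 0" if "j \<le> D" for j
      proof -
        have "(\<Sum>k<N. C k * real k ^ j) = (\<Sum>i\<in>X. C (h i) * real (h i) ^ j)"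
          by (rule reindex[symmetric])
        also have "\<dots> = (\<Sum>i\<in>X. c i * real (h i) ^ j)" by (intro sum.cong) (auto simp: Ch)
        also have "\<dots> = 0"
        proof (cases "j = 0")
          case True
          then show ?thesis using c cZ sum_split[of c] by simp
        next
          case False
          then show ?thesis using inner_low[of j c] c that by simp
        qed
        finally show ?thesis .
      qed
      then have C_eq: "C k = C 0 / d 0 * d k" if "k < N" for k
        using moment_relation_unique[of N C d k] d d0 that unfolding D_def by simp
      have "c i = C 0 / d 0 * w' i" if "i \<in> X" for i
        using Ch[OF that] C_eq[OF hN[OF that]] that unfolding w'_def X_def by simp
      moreover have "c i = C 0 / d 0 * w' i" if "i \<in> Z" for i
        using cZ[OF that] that unfolding w'_def Z_def by simp
      ultimately show "\<exists>t. \<forall>i\<in>I. c i = t * w' i" using IXZ(1) by blast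
    next
      assume "\<exists>t. \<forall>i\<in>I. c i = t * w' i"
      then obtain t where t: "\<And>i. i \<in> I \<Longrightarrow> c i = t * w' i" by blast
      have cX: "c i = t * d (h i)" if "i \<in> X" for i using t[of i] that unfolding X_def w'_def by simp
      have cZ: "c i = 0" if "i \<in> Z" for i using t[of i] that unfolding Z_def w'_def by simp
      have moments: "(\<Sum>i\<in>X. c i * real (h i) ^ j) = 0" if "j \<le> D" for j
      proof -
        have "(\<Sum>i\<in>X. c i * real (h i) ^ j) = (\<Sum>i\<in>X. t * (d (h i) * real (h i) ^ j))"
          by (intro sum.cong) (auto simp: cX)
        also have "\<dots> = (\<Sum>k<N. t * (d k * real k ^ j))" by (rule reindex)
        also have "\<dots> = 0" using d[OF that] by (simp flip: sum_distrib_left)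
        finally show ?thesis .
      qed
      have "sum c I = 0" using moments[of 0] cZ by (simp add: sum_split)
      moreover have "(\<Sum>i\<in>I. c i *\<^sub>R q i) = 0"
      proof (rule euclidean_eqI)
        fix b :: 'a assume "b \<in> Basis"
        then obtain j where j: "j \<in> {1..DIM('a)}" "b = e j" using eB by blast
        show "(\<Sum>i\<in>I. c i *\<^sub>R q i) \<bullet> b = 0 \<bullet> b"
        proof (cases "j \<le> D")
          case True
          then show ?thesis using inner_low[of j c] moments j by simp
        next
          case False
          then show ?thesis using inner_high[of j c] cZ j by (simp add: sum.neutral)
        qed
      qed
      ultimately show "sum c I = 0 \<and> (\<Sum>i\<in>I. c i *\<^sub>R q i) = 0" ..
    qed
  qed
  have cyclic: "is_cyclic_polytope (2 * m) (2 * m - 2) (convex hull (q ` {i \<in> I. w i \<noteq> 0}))"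
  proof -
    have "q ` X = (\<lambda>i. moment_point e D (real (h i))) ` X"
      unfolding q_def X_def by (intro image_cong) auto
    also have "\<dots> = moment_point e D ` real ` {..<N}"
      using h unfolding bij_betw_def by (metis image_image)
    finally have "q ` X = (\<lambda>t. \<Sum>k=1..D. (t ^ k) *\<^sub>R e k) ` real ` {..<N}"
      unfolding moment_point_def .
    moreover have "card (real ` {..<N}) = N" by (simp add: card_image)
    ultimately show ?thesis
      using esub unfolding is_cyclic_polytope_def X_def[symmetric] N_def D_def
      by (intro exI[of _ e] exI[of _ "real ` {..<2 * m}"]) simp
  qed
  show ?thesis using line sgn cyclic by blast
qed

section \<open>The incidence polytope of a 3-coloured simple polytope\<close>

text \<open>
  Colour constants \<open>k\<close> with \<open>k 1 + k 2 + k 3 = 0\<close> give an affine relation iff \<open>m 1 * k 1 + m 2 * k 2 + m 3 * k 3 = 0\<close>, and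
  \<open>m 3 = m 2\<close> turns this into \<open>(m 1 - m 2) * k 1 = 0\<close>.
\<close>

lemma incidence_gale_line:
  fixes P :: "'a::euclidean_space set"
    and vlab :: "'v::finite \<Rightarrow> 'a" and flab :: "'f::finite \<Rightarrow> 'a set"
  assumes P: "simple_3_polytope P" and col: "facet_3_coloring P col"
    and vlab: "bij_betw vlab UNIV (vertices P)" and flab: "bij_betw flab UNIV (facets P)"
    and m: "\<And>i. m i = card {j. col (flab j) = i}"
    and m_rel: "m 3 = m 2" "m 2 \<noteq> m 1" "2 \<le> m 2"
  shows "gale_line UNIV (\<lambda>j. incidence_vec vlab (flab j))
    (\<lambda>j. if col (flab j) = 2 then 1 else if col (flab j) = 3 then -1 else 0)"
    (is "gale_line UNIV ?p ?w")
proof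
  have "{j. 0 < ?w j} = {j. col (flab j) = 2}" "{j. ?w j < 0} = {j. col (flab j) = 3}" by auto
  then show "2 \<le> card {j \<in> UNIV. 0 < ?w j}" "2 \<le> card {j \<in> UNIV. ?w j < 0}"
    using m_rel m[of 2] m[of 3] by simp_all
  have colr: "col (flab j) \<in> {1, 2, 3}" for j
    using flab col unfolding facet_3_coloring_def bij_betw_def by blast
  fix c :: "'f \<Rightarrow> real"
  define C where "C = (\<lambda>f. c (the_inv_into UNIV flab f))"
  have Cf: "C (flab j) = c j" for j
    using flab unfolding C_def bij_betw_def by (simp add: the_inv_into_f_f)
  have comp: "(\<Sum>j\<in>UNIV. c j *\<^sub>R ?p j) $ v = (\<Sum>f\<in>{f \<in> facets P. vlab v \<in> f}. C f)" for v
  proof -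
    have "(\<Sum>j\<in>UNIV. c j *\<^sub>R ?p j) $ v = (\<Sum>j\<in>UNIV. if vlab v \<in> flab j then C (flab j) else 0)"
      unfolding sum_component incidence_vec_def Cf by (intro sum.cong) auto
    also have "\<dots> = (\<Sum>f\<in>facets P. if vlab v \<in> f then C f else 0)"
      by (rule sum.reindex_bij_betw[OF flab])
    also have "\<dots> = (\<Sum>f\<in>{f \<in> facets P. vlab v \<in> f}. C f)"
      using simple_3_polytope_finite(1)[OF P] by (intro sum.inter_filter[symmetric])
    finally show ?thesis .
  qed
  have ranges: "vertices P = range vlab" "facets P = range flab"
    using vlab flab by (simp_all add: bij_betw_def)
  have "(\<Sum>j\<in>UNIV. c j *\<^sub>R ?p j) = 0 \<longleftrightarrow>
      (\<forall>x\<in>vertices P. (\<Sum>f\<in>{f \<in> facets P. x \<in> f}. C f) = 0)"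
    unfolding vec_eq_iff comp zero_index ranges(1) by blast
  also have "\<dots> \<longleftrightarrow> (\<exists>k. (\<forall>f\<in>facets P. C f = k (col f)) \<and> k 1 + k 2 + k 3 = 0)"
    by (rule facet_weights_vanishing_at_vertices[OF P col])
  also have "\<dots> \<longleftrightarrow> (\<exists>k. (\<forall>j. c j = k (col (flab j))) \<and> k 1 + k 2 + k 3 = 0)"
    unfolding ranges(2) by (simp add: Cf)
  finally have linear: "(\<Sum>j\<in>UNIV. c j *\<^sub>R ?p j) = 0 \<longleftrightarrow>
      (\<exists>k. (\<forall>j. c j = k (col (flab j))) \<and> k 1 + k 2 + k 3 = 0)" .
  have total: "sum c UNIV = real (m 1) * k 1 + real (m 2) * k 2 + real (m 3) * k 3"
    if "\<forall>j. c j = k (col (flab j))" for k :: "nat \<Rightarrow> real"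
  proof -
    have "sum c UNIV = (\<Sum>i\<in>{1, 2, 3}. \<Sum>j\<in>{j \<in> UNIV. col (flab j) = i}. c j)"
      using colr by (intro sum.group[symmetric]) auto
    also have "\<dots> = (\<Sum>i\<in>{1, 2, 3}. real (m i) * k i)"
      using that by (intro sum.cong) (auto simp: m)
    finally show ?thesis by simp
  qed
  show "sum c UNIV = 0 \<and> (\<Sum>j\<in>UNIV. c j *\<^sub>R ?p j) = 0 \<longleftrightarrow> (\<exists>t. \<forall>j\<in>UNIV. c j = t * ?w j)"
  proof
    assume c: "sum c UNIV = 0 \<and> (\<Sum>j\<in>UNIV. c j *\<^sub>R ?p j) = 0"
    then obtain k where k: "\<forall>j. c j = k (col (flab j))" "k 1 + k 2 + k 3 = 0" using linear by blast
    have "real (m 1) * k 1 + real (m 2) * k 2 + real (m 3) * k 3 = 0" using total[OF k(1)] c by simp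
    moreover have "k 3 = - k 1 - k 2" using k(2) by simp
    ultimately have "(real (m 1) - real (m 2)) * k 1 = 0" using m_rel(1) by (simp add: algebra_simps)
    then have k1: "k 1 = 0" using m_rel(2) by simp
    have "c j = k 2 * ?w j" for j
    proof -
      have "col (flab j) = 1 \<or> col (flab j) = 2 \<or> col (flab j) = 3" using colr[of j] by simp
      then show ?thesis using k k1 by auto
    qed
    then show "\<exists>t. \<forall>j\<in>UNIV. c j = t * ?w j" by blast
  next
    assume "\<exists>t. \<forall>j\<in>UNIV. c j = t * ?w j"
    then obtain t where t: "\<And>j. c j = t * ?w j" by blast
    define k where "k = (\<lambda>i::nat. t * (if i = 2 then 1 else if i = 3 then -1 else 0))"
    have k: "\<forall>j. c j = k (col (flab j))" "k 1 + k 2 + k 3 = 0" using t unfolding k_def by auto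
    moreover have "sum c UNIV = 0" using total[OF k(1)] m_rel(1) by (simp add: k_def)
    ultimately show "sum c UNIV = 0 \<and> (\<Sum>j\<in>UNIV. c j *\<^sub>R ?p j) = 0" using linear by blast
  qed
qed simp

theorem proposition4p2:
  fixes P :: "'a::euclidean_space set"
    and n :: nat
    and vlab :: "'v::finite \<Rightarrow> 'a"
    and flab :: "'f::finite \<Rightarrow> 'a set"
    and col :: "'a set \<Rightarrow> nat"
    and m :: "nat \<Rightarrow> nat"
    and S :: "(real^'v) set"
    and V :: "nat \<Rightarrow> (real^'v) set"
    and Pt :: "(real^'v) set"
  assumes P: "three_colorable P"
    and vlab: "bij_betw vlab UNIV (vertices P)"
    and n: "CARD('v) = 2 * n"
    and flab: "bij_betw flab UNIV (facets P)"
    and col: "facet_3_coloring P col"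
    and m: "\<And>i. m i = card (color_class P col i)"
    and S: "S = incidence_vec vlab ` facets P"
    and V: "\<And>i. V i = incidence_vec vlab ` color_class P col i"
    and Pt: "Pt = incidence_polytope vlab P"
    and m_rel: "m 3 = m 2" "m 2 > m 1" "m 1 \<ge> 2"
  shows "polytope_gale_diagram (\<lambda>j. incidence_vec vlab (flab j)) Pt
           (replicate_mset (m 1) (0::real) + replicate_mset (m 2) 1 + replicate_mset (m 3) (-1))
       \<and> (\<forall>J. J \<subset> S \<longrightarrow>
            (proper_face_of (convex hull J) Pt \<longleftrightarrow>
               (\<not> V 2 \<subseteq> J \<and> \<not> V 3 \<subseteq> J) \<or> V 2 \<union> V 3 \<subseteq> J))
       \<and> \<not> simplicial_polytope Pt
       \<and> (\<exists>K Q :: (real^'v) set.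
            is_cyclic_polytope (2 * m 2) (2 * m 2 - 2) K \<and>
            is_fold_pyramid (m 1) (int n) K Q \<and>
            combinatorially_equivalent Pt Q)"
proof -
  have simple: "simple_3_polytope P" using P unfolding three_colorable_def by simp
  have colr: "col (flab j) \<in> {1, 2, 3}" for j
    using flab col unfolding facet_3_coloring_def bij_betw_def by blast
  have flab_facet: "flab j \<in> facets P" for j using flab unfolding bij_betw_def by auto
  have flab_inj: "inj flab" and flab_range: "facets P = range flab"
    using flab by (simp_all add: bij_betw_def)
  have class_eq: "color_class P col i = flab ` {j. col (flab j) = i}" for i
    unfolding color_class_def flab_range by auto
  have m': "m i = card {j. col (flab j) = i}" for i
    unfolding m class_eq by (rule card_image[OF inj_on_subset[OF flab_inj subset_UNIV]])
  define p where "p = (\<lambda>j. incidence_vec vlab (flab j))"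
  define w where "w = (\<lambda>j. if col (flab j) = 2 then 1 else if col (flab j) = 3 then -1 else (0::real))"
  have line: "gale_line UNIV p w"
    unfolding p_def w_def using m_rel m'
    by (intro incidence_gale_line[OF simple col vlab flab, of m]) auto
  interpret gale_line UNIV p w by (rule line)
  have S_eq: "S = range p" unfolding S flab_range p_def by (simp add: image_image)
  have Pt_eq: "Pt = convex hull (range p)"
    using Pt S_eq S unfolding incidence_polytope_def by simp
  have V_eq: "V i = p ` {j. col (flab j) = i}" for i
    unfolding V class_eq p_def by (simp add: image_image)
  have pos_eq: "{j \<in> UNIV. 0 < w j} = {j. col (flab j) = 2}"
    and neg_eq: "{j \<in> UNIV. w j < 0} = {j. col (flab j) = 3}"
    and zero_eq: "{j \<in> UNIV. w j = 0} = {j. col (flab j) = 1}"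
    and nonzero_eq: "{j \<in> UNIV. w j \<noteq> 0} = {j. col (flab j) = 2} \<union> {j. col (flab j) = 3}"
    using colr unfolding w_def by auto

  have n_eq: "CARD('f) = n + 2" and card_eq: "CARD('f) = m 1 + 2 * m 2"
  proof -
    have "card (vertices P) = 2 * n" "card (facets P) = CARD('f)"
      using vlab flab n by (simp_all add: bij_betw_same_card[symmetric])
    then show "CARD('f) = n + 2" using simple_3_polytope_euler[OF simple] by simp
    have "CARD('f) = (\<Sum>i\<in>{1, 2, 3}. card {j \<in> UNIV. col (flab j) = i})"
      using colr by (subst card_eq_sum, subst sum.group[symmetric, of UNIV "{1, 2, 3}" "\<lambda>j. col (flab j)"]) auto
    then show "CARD('f) = m 1 + 2 * m 2" using m' m_rel(1) by simp
  qed

  have gale: "polytope_gale_diagram p Pt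
      (replicate_mset (m 1) (0::real) + replicate_mset (m 2) 1 + replicate_mset (m 3) (-1))"
  proof -
    have "bij_betw p UNIV (vertices Pt)"
      unfolding bij_betw_def Pt_eq vertices_hull using inj_points by simp
    moreover have "replicate_mset (m 1) (0::real) + replicate_mset (m 2) 1 + replicate_mset (m 3) (-1)
        = image_mset (\<lambda>j. sgn (w j)) (mset_set UNIV)"
    proof (rule multiset_eqI)
      fix x :: real
      have "sgn (w j) = w j" for j unfolding w_def by simp
      then have "count (image_mset (\<lambda>j. sgn (w j)) (mset_set UNIV)) x = card {j. x = w j}"
        by (simp add: count_image_mset')
      also have "{j. x = w j} = (if x = 0 then {j. col (flab j) = 1} else if x = 1 then {j. col (flab j) = 2}
          else if x = -1 then {j. col (flab j) = 3} else {})"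
        using zero_eq unfolding w_def by auto
      also have "card \<dots> = (if x = 0 then m 1 else if x = 1 then m 2 else if x = -1 then m 3 else 0)"
        unfolding m' by simp
      finally show "count (replicate_mset (m 1) 0 + replicate_mset (m 2) 1 + replicate_mset (m 3) (-1)) x
          = count (image_mset (\<lambda>j. sgn (w j)) (mset_set UNIV)) x" by simp
    qed
    ultimately show ?thesis
      unfolding polytope_gale_diagram_def gale_diagram_def
      using gale_line_gale_transform[OF line] by blast
  qed

  have faces: "proper_face_of (convex hull J) Pt \<longleftrightarrow>
      (\<not> V 2 \<subseteq> J \<and> \<not> V 3 \<subseteq> J) \<or> V 2 \<union> V 3 \<subseteq> J" if J: "J \<subset> S" for J
  proof -
    obtain J0 where J0: "J = p ` J0"
      using J unfolding S_eq by (meson psubset_imp_subset subset_imageE)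
    have "J0 \<noteq> UNIV" using J J0 S_eq by auto
    then have "convex hull J \<noteq> Pt" unfolding J0 Pt_eq using hull_eq_iff[of J0 UNIV] by simp
    moreover have "convex hull J face_of Pt \<longleftrightarrow> gale_face UNIV w J0"
      unfolding J0 Pt_eq by (rule face_iff_gale_face) simp
    moreover have "V i \<subseteq> J \<longleftrightarrow> {j. col (flab j) = i} \<subseteq> J0" for i
      unfolding J0 V_eq using inj_points by (simp add: inj_image_subset_iff)
    ultimately show ?thesis
      unfolding proper_face_of_def gale_face_def pos_eq neg_eq nonzero_eq by simp
  qed

  have "card {j. col (flab j) = 1} \<noteq> 0" using m_rel(3) unfolding m'[of 1] by linarith
  then have "{j. col (flab j) = 1} \<noteq> {}" by (metis card.empty)
  then have "\<exists>j\<in>UNIV. w j = 0" using zero_eq by blast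
  then have not_simplicial: "\<not> simplicial_polytope Pt"
    unfolding Pt_eq by (rule gale_line_not_simplicial[OF line])

  have "\<exists>K Q :: (real^'v) set. is_cyclic_polytope (2 * m 2) (2 * m 2 - 2) K \<and>
      is_fold_pyramid (m 1) (int n) K Q \<and> combinatorially_equivalent Pt Q"
  proof -
    define X where "X = {j \<in> UNIV. w j \<noteq> 0}"
    define Z where "Z = {j \<in> UNIV. w j = 0}"
    have XZ: "X \<union> Z = UNIV" "Z \<inter> X = {}" unfolding X_def Z_def by auto
    have cardZ: "card Z = m 1" using m'[of 1] unfolding Z_def zero_eq by simp
    have cardXZ: "card X + card Z = CARD('f)"
      using XZ by (metis card_Un_disjoint finite inf_commute)
    have pos: "card {j \<in> UNIV. 0 < w j} = m 2" and neg: "card {j \<in> UNIV. w j < 0} = m 2"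
      using m' m_rel(1) unfolding pos_eq neg_eq by simp_all
    have dim: "CARD('f) \<le> DIM(real^'v) + 2" using n n_eq by simp
    have "2 \<le> m 2" using m_rel by simp
    then have "\<exists>(q :: 'f \<Rightarrow> real^'v) w'. gale_line UNIV q w' \<and> (\<forall>j\<in>UNIV. sgn (w j) = sgn (w' j)) \<and>
        is_cyclic_polytope (2 * m 2) (2 * m 2 - 2) (convex hull (q ` X))"
      unfolding X_def by (rule cyclic_pyramid_gale_line[OF finite_class.finite_UNIV pos neg _ dim])
    then obtain q :: "'f \<Rightarrow> real^'v" and w' where q: "gale_line UNIV q w'"
      and sgn: "\<forall>j\<in>UNIV. sgn (w j) = sgn (w' j)"
      and cyclic: "is_cyclic_polytope (2 * m 2) (2 * m 2 - 2) (convex hull (q ` X))"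
      by blast
    have "is_fold_pyramid (card Z) (int (card X + card Z) - 2)
        (convex hull (q ` X)) (convex hull (q ` (X \<union> Z)))"
    proof (rule gale_line_fold_pyramid)
      show "gale_line (X \<union> Z) q w'" unfolding XZ(1) by (rule q)
      show "w' a = 0" if "a \<in> Z" for a
      proof -
        have "w a = 0" using that unfolding Z_def by simp
        then have "sgn (w' a) = 0" using bspec[OF sgn UNIV_I, of a] by (metis sgn_0)
        then show ?thesis by (simp only: sgn_0_0)
      qed
    qed (use XZ in auto)
    moreover have "int (card X + card Z) - 2 = int n" unfolding cardXZ n_eq by simp
    ultimately have "is_fold_pyramid (m 1) (int n) (convex hull (q ` X)) (convex hull (range q))"
      unfolding XZ(1) cardZ by simp
    moreover have "combinatorially_equivalent Pt (convex hull (range q))"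
      unfolding Pt_eq by (rule gale_line_combinatorially_equivalent[OF line q bspec[OF sgn]])
    ultimately show ?thesis using cyclic by blast
  qed
  then show ?thesis using gale faces not_simplicial unfolding p_def by blast
qed

end
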